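(* Let $A$ be a quasitriangular quasi-Hopf algebra over a field $K$ with R-matrix $R$, antipode $S$ and Drinfel'd element $u$, and let $v \in A$ be a ribbon element, i.e. a nonzero central element of $A$ satisfying $\Delta(v) = (R'R)(v \otimes v)$ and $S(v) = v$. Then $v$ is invertible and $v^{-2} = u\, S(u)$.
   Context: All tensor products are over a fixed field $K$. A quasi-bialgebra $(A,\Delta,\varepsilon,\Phi)$ is an associative unital $K$-algebra $A$ with algebra homomorphisms $\Delta: A \to A\otimes A$ and $\varepsilon: A \to K$ and an invertible element $\Phi \in A\otimes A\otimes A$ such that, for all $a \in A$: (1) $(\mathrm{id}\otimes\Delta)\Delta(a)\,\Phi = \Phi\,(\Delta\otimes\mathrm{id})\Delta(a)$; (2) $(\mathrm{id}\otimes\mathrm{id}\otimes\Delta)(\Phi)(\Delta\otimes\mathrm{id}\otimes\mathrm{id})(\Phi) = (1\otimes\Phi)(\mathrm{id}\otimes\Delta\otimes\mathrm{id})(\Phi)(\Phi\otimes 1)$; (3) $(\varepsilon\otimes\mathrm{id})\Delta(a) = a = (\mathrm{id}\otimes\varepsilon)\Delta(a)$; (4) $(\mathrm{id}\otimes\varepsilon\otimes\mathrm{id})(\Phi) = 1\otimes 1$. Notation: $\Delta(a) = a_{(1)}\otimes a_{(2)}$, $\Delta^{\mathrm{cop}}(a) = a_{(2)}\otimes a_{(1)}$, $\Phi = \sum_i X_i\otimes Y_i\otimes Z_i$, $\Phi^{-1} = \sum_j \bar X_j\otimes\bar Y_j\otimes\bar Z_j$. A quasi-Hopf algebra is a quasi-bialgebra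 with an algebra anti-automorphism $S: A\to A$ (the antipode, in particular bijective) and elements $\alpha,\beta\in A$ such that, for all $a\in A$, $S(a_{(1)})\alpha a_{(2)} = \varepsilon(a)\alpha$, $a_{(1)}\beta S(a_{(2)}) = \varepsilon(a)\beta$, and $\sum_i X_i\beta S(Y_i)\alpha Z_i = 1 = \sum_j S(\bar X_j)\alpha\bar Y_j\beta S(\bar Z_j)$. A quasi-Hopf algebra is quasitriangular if it is endowed with an R-matrix, i.e. an invertible element $R = \sum_l s_l\otimes t_l\in A\otimes A$ such that (1) $\Delta^{\mathrm{cop}}(a)R = R\Delta(a)$ for all $a\in A$; (2) $(\Delta\otimes\mathrm{id})(R) = \sum_{i,j,k,l,q} Y_i s_l\bar X_j X_k\otimes Z_i\bar Z_j s_q Y_k\otimes X_i t_l\bar Y_j t_q Z_k$; (3) $(\mathrm{id}\otimes\Delta)(R) = \sum_{i,j,k,l,q}\bar Z_i s_l Y_j s_q\bar X_k\otimes\bar X_i X_j t_q\bar Y_k\otimes\bar Y_i t_l Z_j\bar Z_k$. $R' = \sum_l t_l\otimes s_l$ denotes the image of $R$ under interchange of the tensor factors. The Drinfel'd element is $u := \sum_{i,l} S(\bar Y_i\beta S(\bar Z_i))\,S(t_l)\,\alpha\, s_l\,\bar X_i$. *)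

theory Defs
  imports Complex_Main "HOL-Library.Poly_Mapping"
begin

locale k_algebra = vector_space scale
  for scale :: "'k::field \<Rightarrow> 'a::ring_1 \<Rightarrow> 'a"  (infixr "*s" 75) +
  assumes scale_mult_left: "(c *s a) * b = c *s (a * b)"
    and scale_mult_right: "a * (c *s b) = c *s (a * b)"

text \<open>
  The tensor power of order n is the free vector space on the words of length n
  over the algebra (the word \<open>[a\<^sub>1, ..., a\<^sub>n]\<close> standing for the pure tensor of its
  letters), modulo the subspace spanned by the multilinearity relations. A tensor is thus a
  coset of finitely supported functions on words.
\<close>

type_synonym ('a, 'k) formal = "'a list \<Rightarrow>\<^sub>0 'k"
type_synonym ('a, 'k) tensor = "('a, 'k) formal set"

definition fscale :: "'k::field \<Rightarrow> ('b \<Rightarrow>\<^sub>0 'k) \<Rightarrow> ('b \<Rightarrow>\<^sub>0 'k)"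
  where "fscale c x = Poly_Mapping.map ((*) c) x"

definition word :: "'a list \<Rightarrow> ('a, 'k::field) formal"
  where "word w = Poly_Mapping.single w 1"

definition lin_ext :: "('k::field \<Rightarrow> 'v \<Rightarrow> 'v::ab_group_add) \<Rightarrow> ('b \<Rightarrow>\<^sub>0 'k) \<Rightarrow> ('b \<Rightarrow> 'v) \<Rightarrow> 'v"
  where "lin_ext sc x F = (\<Sum>w\<in>Poly_Mapping.keys x. sc (Poly_Mapping.lookup x w) (F w))"

lemma lookup_fscale [simp]:
  "Poly_Mapping.lookup (fscale c x) w = c * Poly_Mapping.lookup x w"
  unfolding fscale_def by (simp add: Poly_Mapping.map.rep_eq when_def)

lemma vector_space_fscale: "vector_space fscale"
  by standard (auto intro!: poly_mapping_eqI simp: lookup_add algebra_simps)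

lemma lin_ext_superset:
  assumes "vector_space sc" "finite B" "Poly_Mapping.keys x \<subseteq> B"
  shows "lin_ext sc x F = (\<Sum>w\<in>B. sc (Poly_Mapping.lookup x w) (F w))"
proof -
  interpret V: vector_space sc by fact
  show ?thesis
    unfolding lin_ext_def
    by (rule sum.mono_neutral_left)
      (use assms in \<open>auto simp: in_keys_iff\<close>)
qed

lemma lin_ext_linear:
  fixes sc :: "'k::field \<Rightarrow> 'v \<Rightarrow> 'v::ab_group_add" and F :: "'b \<Rightarrow> 'v"
  assumes "vector_space sc"
  shows "Vector_Spaces.linear fscale sc (\<lambda>x. lin_ext sc x F)"
proof -
  interpret V: vector_space sc by fact
  interpret P: vector_space "fscale :: 'k \<Rightarrow> ('b \<Rightarrow>\<^sub>0 'k) \<Rightarrow> _" by (rule vector_space_fscale)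
  show ?thesis
  proof
    fix x y :: "'b \<Rightarrow>\<^sub>0 'k"
    let ?B = "Poly_Mapping.keys x \<union> Poly_Mapping.keys y"
    have "lin_ext sc (x + y) F
        = (\<Sum>w\<in>?B. sc (Poly_Mapping.lookup (x + y) w) (F w))"
      by (rule lin_ext_superset[OF assms]) (auto dest: subsetD[OF Poly_Mapping.keys_add])
    also have "\<dots> = (\<Sum>w\<in>?B. sc (Poly_Mapping.lookup x w) (F w))
        + (\<Sum>w\<in>?B. sc (Poly_Mapping.lookup y w) (F w))"
      by (simp add: lookup_add V.scale_left_distrib sum.distrib)
    also have "\<dots> = lin_ext sc x F + lin_ext sc y F"
      by (subst (1 2) lin_ext_superset[OF assms, of ?B]) auto
    finally show "lin_ext sc (x + y) F = lin_ext sc x F + lin_ext sc y F" .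
  next
    fix c and x :: "'b \<Rightarrow>\<^sub>0 'k"
    have "lin_ext sc (fscale c x) F
        = (\<Sum>w\<in>Poly_Mapping.keys x. sc (Poly_Mapping.lookup (fscale c x) w) (F w))"
      by (rule lin_ext_superset[OF assms]) (auto simp: in_keys_iff)
    then show "lin_ext sc (fscale c x) F = sc c (lin_ext sc x F)"
      by (simp add: lin_ext_def V.scale_sum_right)
  qed
qed

lemma lin_ext_word: "vector_space sc \<Longrightarrow> lin_ext sc (word w) F = F w"
proof -
  assume "vector_space sc"
  then interpret V: vector_space sc .
  show ?thesis by (simp add: lin_ext_def word_def)
qed

context k_algebra
begin

definition relators :: "nat \<Rightarrow> ('a, 'k) formal set"
  where "relators n =
    {word (p @ (a + b) # q) - word (p @ a # q) - word (p @ b # q) | p q a b.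
       length p + 1 + length q = n} \<union>
    {word (p @ (c *s a) # q) - fscale c (word (p @ a # q)) | p q c a.
       length p + 1 + length q = n}"

definition null_tensors :: "nat \<Rightarrow> ('a, 'k) formal set"
  where "null_tensors n = module.span fscale (relators n)"

definition tclass :: "nat \<Rightarrow> ('a, 'k) formal \<Rightarrow> ('a, 'k) tensor"
  where "tclass n x = {y. y - x \<in> null_tensors n}"

definition tensor_power :: "nat \<Rightarrow> ('a, 'k) tensor set"
  where "tensor_power n = tclass n ` {x. \<forall>w\<in>Poly_Mapping.keys x. length w = n}"

definition tpure :: "'a list \<Rightarrow> ('a, 'k) tensor"
  where "tpure w = tclass (length w) (word w)"

text \<open>
  Sweedler-style sums: if X is the class of \<open>\<Sum>\<^sub>w c\<^sub>w w\<close>, then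
  \<open>tsum sc X F\<close> is \<open>\<Sum>\<^sub>w c\<^sub>w F w\<close>, formed with the scalar multiplication \<open>sc\<close> of the
  target. It is evaluated on a chosen representative of the coset; for multilinear F the choice
  is irrelevant, see \<open>tsum_well_defined\<close> below. Operations on tensors whose value is again a tensor
  are computed by a sum of formal words (\<open>sc = fscale\<close>) whose class is taken at the end.
\<close>

definition trep :: "('a, 'k) tensor \<Rightarrow> ('a, 'k) formal"
  where "trep X = (SOME x. x \<in> X)"

definition tsum ::
    "('k \<Rightarrow> 'v \<Rightarrow> 'v::ab_group_add) \<Rightarrow> ('a, 'k) tensor \<Rightarrow> ('a list \<Rightarrow> 'v) \<Rightarrow> 'v"
  where "tsum sc X F = lin_ext sc (trep X) F"

definition tsum2 ::
    "('k \<Rightarrow> 'v \<Rightarrow> 'v::ab_group_add) \<Rightarrow> ('a, 'k) tensor \<Rightarrow> ('a \<Rightarrow> 'a \<Rightarrow> 'v) \<Rightarrow> 'v"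
  where "tsum2 sc X F = tsum sc X (\<lambda>w. F (w ! 0) (w ! 1))"

definition tsum3 ::
    "('k \<Rightarrow> 'v \<Rightarrow> 'v::ab_group_add) \<Rightarrow> ('a, 'k) tensor \<Rightarrow> ('a \<Rightarrow> 'a \<Rightarrow> 'a \<Rightarrow> 'v) \<Rightarrow> 'v"
  where "tsum3 sc X F = tsum sc X (\<lambda>w. F (w ! 0) (w ! 1) (w ! 2))"

text \<open>
  \<open>U\<close> is a subspace: \<open>U = {0}\<close> gives multilinearity, \<open>U = null_tensors m\<close> gives multilinearity
  into the tensor power of order m.
\<close>

definition multilinear_mod ::
    "('k \<Rightarrow> 'v \<Rightarrow> 'v::ab_group_add) \<Rightarrow> 'v set \<Rightarrow> nat \<Rightarrow> ('a list \<Rightarrow> 'v) \<Rightarrow> bool"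
  where "multilinear_mod sc U n F \<longleftrightarrow>
    (\<forall>p q a b c. length p + 1 + length q = n \<longrightarrow>
       F (p @ (a + b) # q) - F (p @ a # q) - F (p @ b # q) \<in> U \<and>
       F (p @ (c *s a) # q) - sc c (F (p @ a # q)) \<in> U)"

definition tadd :: "nat \<Rightarrow> ('a, 'k) tensor \<Rightarrow> ('a, 'k) tensor \<Rightarrow> ('a, 'k) tensor"
  where "tadd n X Y = tclass n (trep X + trep Y)"

definition tscale :: "nat \<Rightarrow> 'k \<Rightarrow> ('a, 'k) tensor \<Rightarrow> ('a, 'k) tensor"
  where "tscale n c X = tclass n (fscale c (trep X))"

definition tmult :: "nat \<Rightarrow> ('a, 'k) tensor \<Rightarrow> ('a, 'k) tensor \<Rightarrow> ('a, 'k) tensor"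
  where "tmult n X Y =
    tclass n (tsum fscale X (\<lambda>v. tsum fscale Y (\<lambda>w. word (map2 (*) v w))))"

definition tone :: "nat \<Rightarrow> ('a, 'k) tensor"
  where "tone n = tpure (replicate n 1)"

definition is_tinverse :: "nat \<Rightarrow> ('a, 'k) tensor \<Rightarrow> ('a, 'k) tensor \<Rightarrow> bool"
  where "is_tinverse n X Y \<longleftrightarrow>
    Y \<in> tensor_power n \<and> tmult n X Y = tone n \<and> tmult n Y X = tone n"

definition tinvertible :: "nat \<Rightarrow> ('a, 'k) tensor \<Rightarrow> bool"
  where "tinvertible n X \<longleftrightarrow> X \<in> tensor_power n \<and> (\<exists>Y. is_tinverse n X Y)"

definition tinv :: "nat \<Rightarrow> ('a, 'k) tensor \<Rightarrow> ('a, 'k) tensor"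
  where "tinv n X = (THE Y. is_tinverse n X Y)"

definition tflip :: "('a, 'k) tensor \<Rightarrow> ('a, 'k) tensor"
  where "tflip X = tclass 2 (tsum2 fscale X (\<lambda>a b. word [b, a]))"

definition one_tensor :: "nat \<Rightarrow> ('a, 'k) tensor \<Rightarrow> ('a, 'k) tensor"
  where "one_tensor n X = tclass (n + 1) (tsum fscale X (\<lambda>w. word (1 # w)))"

definition tensor_one :: "nat \<Rightarrow> ('a, 'k) tensor \<Rightarrow> ('a, 'k) tensor"
  where "tensor_one n X = tclass (n + 1) (tsum fscale X (\<lambda>w. word (w @ [1])))"

text \<open>
  \<open>comult_at \<Delta> n i\<close> and \<open>counit_at \<epsilon> n i\<close> apply \<open>\<Delta>\<close>, resp. \<open>\<epsilon>\<close>, to the tensor factor with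
  index i (counted from 0) of a tensor with n factors and the identity to the others. The
  factor in K produced by \<open>\<epsilon>\<close> is absorbed as a scalar. Thus \<open>comult_at \<Delta> 3 1\<close> is
  \<open>id \<otimes> \<Delta> \<otimes> id\<close>.
\<close>

definition comult_at ::
    "('a \<Rightarrow> ('a, 'k) tensor) \<Rightarrow> nat \<Rightarrow> nat \<Rightarrow> ('a, 'k) tensor \<Rightarrow> ('a, 'k) tensor"
  where "comult_at \<Delta> n i X = tclass (n + 1)
    (tsum fscale X (\<lambda>w. tsum fscale (\<Delta> (w ! i)) (\<lambda>d. word (take i w @ d @ drop (i + 1) w))))"

definition counit_at ::
    "('a \<Rightarrow> 'k) \<Rightarrow> nat \<Rightarrow> nat \<Rightarrow> ('a, 'k) tensor \<Rightarrow> ('a, 'k) tensor"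
  where "counit_at \<epsilon> n i X = tclass (n - 1)
    (tsum fscale X (\<lambda>w. fscale (\<epsilon> (w ! i)) (word (take i w @ drop (i + 1) w))))"

lemma lin_ext_null:
  assumes sc: "vector_space sc" and U: "module.subspace sc U"
    and F: "multilinear_mod sc U n F" and x: "x \<in> null_tensors n"
  shows "lin_ext sc x F \<in> U"
proof -
  interpret V: vector_space sc by fact
  interpret P: vector_space "fscale :: 'k \<Rightarrow> ('a, 'k) formal \<Rightarrow> _" by (rule vector_space_fscale)
  interpret L: Vector_Spaces.linear "fscale :: 'k \<Rightarrow> ('a, 'k) formal \<Rightarrow> _" sc "\<lambda>x. lin_ext sc x F"
    by (rule lin_ext_linear[OF sc])
  have *: "lin_ext sc y F \<in> U" if "y \<in> relators n" for y
    using that F unfolding relators_def multilinear_mod_def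
    by (auto simp: L.diff L.scale lin_ext_word[OF sc])
  have "P.subspace {y. lin_ext sc y F \<in> U}"
    using U by (auto simp: P.subspace_def V.subspace_def L.zero L.add L.scale)
  then have "P.span (relators n) \<subseteq> {y. lin_ext sc y F \<in> U}"
    using * by (intro P.span_minimal) auto
  then show ?thesis using x by (auto simp: null_tensors_def)
qed

lemma tsum_well_defined:
  assumes sc: "vector_space sc" and U: "module.subspace sc U" and F: "multilinear_mod sc U n F"
  shows "tsum sc (tclass n x) F - lin_ext sc x F \<in> U"
proof -
  interpret P: vector_space "fscale :: 'k \<Rightarrow> ('a, 'k) formal \<Rightarrow> _" by (rule vector_space_fscale)
  interpret L: Vector_Spaces.linear "fscale :: 'k \<Rightarrow> ('a, 'k) formal \<Rightarrow> _" sc "\<lambda>x. lin_ext sc x F"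
    by (rule lin_ext_linear[OF sc])
  have "x \<in> tclass n x"
    by (simp add: tclass_def null_tensors_def P.span_zero)
  then have "trep (tclass n x) \<in> tclass n x"
    unfolding trep_def by (rule someI)
  then have "trep (tclass n x) - x \<in> null_tensors n"
    by (simp add: tclass_def)
  from lin_ext_null[OF sc U F this] show ?thesis
    by (simp add: tsum_def L.diff)
qed

end

locale quasi_bialgebra = k_algebra scale
  for scale :: "'k::field \<Rightarrow> 'a::ring_1 \<Rightarrow> 'a"  (infixr "*s" 75) +
  fixes \<Delta> :: "'a \<Rightarrow> ('a, 'k) tensor"
    and \<epsilon> :: "'a \<Rightarrow> 'k"
    and \<Phi> :: "('a, 'k) tensor"
  assumes comult_closed: "\<Delta> a \<in> tensor_power 2"
    and comult_add: "\<Delta> (a + b) = tadd 2 (\<Delta> a) (\<Delta> b)"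
    and comult_scale: "\<Delta> (c *s a) = tscale 2 c (\<Delta> a)"
    and comult_mult: "\<Delta> (a * b) = tmult 2 (\<Delta> a) (\<Delta> b)"
    and comult_one: "\<Delta> 1 = tone 2"
    and counit_linear: "Vector_Spaces.linear scale (*) \<epsilon>"
    and counit_mult: "\<epsilon> (a * b) = \<epsilon> a * \<epsilon> b"
    and counit_one: "\<epsilon> 1 = 1"
    and Phi_invertible: "tinvertible 3 \<Phi>"
    and quasi_coassoc:
      "tmult 3 (comult_at \<Delta> 2 1 (\<Delta> a)) \<Phi> = tmult 3 \<Phi> (comult_at \<Delta> 2 0 (\<Delta> a))"
    and pentagon:
      "tmult 4 (comult_at \<Delta> 3 2 \<Phi>) (comult_at \<Delta> 3 0 \<Phi>)
       = tmult 4 (tmult 4 (one_tensor 3 \<Phi>) (comult_at \<Delta> 3 1 \<Phi>)) (tensor_one 3 \<Phi>)"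
    and counit_left: "tsum2 scale (\<Delta> a) (\<lambda>a1 a2. \<epsilon> a1 *s a2) = a"
    and counit_right: "tsum2 scale (\<Delta> a) (\<lambda>a1 a2. \<epsilon> a2 *s a1) = a"
    and counit_Phi: "counit_at \<epsilon> 3 1 \<Phi> = tone 2"

locale quasi_hopf_algebra = quasi_bialgebra scale \<Delta> \<epsilon> \<Phi>
  for scale :: "'k::field \<Rightarrow> 'a::ring_1 \<Rightarrow> 'a"  (infixr "*s" 75)
    and \<Delta> :: "'a \<Rightarrow> ('a, 'k) tensor"
    and \<epsilon> :: "'a \<Rightarrow> 'k"
    and \<Phi> :: "('a, 'k) tensor" +
  fixes S :: "'a \<Rightarrow> 'a"
    and \<alpha> \<beta> :: 'a
  assumes antipode_linear: "Vector_Spaces.linear scale scale S"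
    and antipode_mult: "S (a * b) = S b * S a"
    and antipode_one: "S 1 = 1"
    and antipode_bij: "bij S"
    and antipode_alpha: "tsum2 scale (\<Delta> a) (\<lambda>a1 a2. S a1 * \<alpha> * a2) = \<epsilon> a *s \<alpha>"
    and antipode_beta: "tsum2 scale (\<Delta> a) (\<lambda>a1 a2. a1 * \<beta> * S a2) = \<epsilon> a *s \<beta>"
    and antipode_Phi: "tsum3 scale \<Phi> (\<lambda>X Y Z. X * \<beta> * S Y * \<alpha> * Z) = 1"
    and antipode_Phi_inv:
      "tsum3 scale (tinv 3 \<Phi>) (\<lambda>X Y Z. S X * \<alpha> * Y * \<beta> * S Z) = 1"

locale quasitriangular_quasi_hopf_algebra = quasi_hopf_algebra scale \<Delta> \<epsilon> \<Phi> S \<alpha> \<beta>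
  for scale :: "'k::field \<Rightarrow> 'a::ring_1 \<Rightarrow> 'a"  (infixr "*s" 75)
    and \<Delta> :: "'a \<Rightarrow> ('a, 'k) tensor"
    and \<epsilon> :: "'a \<Rightarrow> 'k"
    and \<Phi> :: "('a, 'k) tensor"
    and S :: "'a \<Rightarrow> 'a"
    and \<alpha> \<beta> :: 'a +
  fixes R :: "('a, 'k) tensor"
  assumes R_invertible: "tinvertible 2 R"
    and R_comult: "tmult 2 (tflip (\<Delta> a)) R = tmult 2 R (\<Delta> a)"
    and hexagon_left:
      "comult_at \<Delta> 2 0 R = tclass 3
        (tsum3 fscale \<Phi> (\<lambda>X\<^sub>i Y\<^sub>i Z\<^sub>i.
         tsum3 fscale (tinv 3 \<Phi>) (\<lambda>X\<^sub>j Y\<^sub>j Z\<^sub>j.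
         tsum3 fscale \<Phi> (\<lambda>X\<^sub>k Y\<^sub>k Z\<^sub>k.
         tsum2 fscale R (\<lambda>s\<^sub>l t\<^sub>l.
         tsum2 fscale R (\<lambda>s\<^sub>q t\<^sub>q.
           word [Y\<^sub>i * s\<^sub>l * X\<^sub>j * X\<^sub>k, Z\<^sub>i * Z\<^sub>j * s\<^sub>q * Y\<^sub>k, X\<^sub>i * t\<^sub>l * Y\<^sub>j * t\<^sub>q * Z\<^sub>k]))))))"
    and hexagon_right:
      "comult_at \<Delta> 2 1 R = tclass 3
        (tsum3 fscale (tinv 3 \<Phi>) (\<lambda>X\<^sub>i Y\<^sub>i Z\<^sub>i.
         tsum3 fscale \<Phi> (\<lambda>X\<^sub>j Y\<^sub>j Z\<^sub>j.
         tsum3 fscale (tinv 3 \<Phi>) (\<lambda>X\<^sub>k Y\<^sub>k Z\<^sub>k.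
         tsum2 fscale R (\<lambda>s\<^sub>l t\<^sub>l.
         tsum2 fscale R (\<lambda>s\<^sub>q t\<^sub>q.
           word [Z\<^sub>i * s\<^sub>l * Y\<^sub>j * s\<^sub>q * X\<^sub>k, X\<^sub>i * X\<^sub>j * t\<^sub>q * Y\<^sub>k, Y\<^sub>i * t\<^sub>l * Z\<^sub>j * Z\<^sub>k]))))))"

definition (in k_algebra) drinfeld_element ::
    "('a, 'k) tensor \<Rightarrow> ('a \<Rightarrow> 'a) \<Rightarrow> 'a \<Rightarrow> 'a \<Rightarrow> ('a, 'k) tensor \<Rightarrow> 'a"
  where "drinfeld_element \<Phi> S \<alpha> \<beta> R =
    tsum3 scale (tinv 3 \<Phi>) (\<lambda>X Y Z.
      tsum2 scale R (\<lambda>s t. S (Y * \<beta> * S Z) * S t * \<alpha> * s * X))"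

definition (in k_algebra) ribbon_element ::
    "('a \<Rightarrow> ('a, 'k) tensor) \<Rightarrow> ('a \<Rightarrow> 'a) \<Rightarrow> ('a, 'k) tensor \<Rightarrow> 'a \<Rightarrow> bool"
  where "ribbon_element \<Delta> S R v \<longleftrightarrow>
    v \<noteq> 0 \<and> (\<forall>a. v * a = a * v) \<and>
    \<Delta> v = tmult 2 (tmult 2 (tflip R) R) (tpure [v, v]) \<and> S v = v"

end

theory Submission
  imports Defs
begin

text \<open>
  Put \<open>\<gamma> = \<Sum> S(t) \<alpha> s\<close>, summed over \<open>R = \<Sum> s \<otimes> t\<close>. Uniqueness of the antipode, applied to the
  opposite comultiplication, gives \<open>u a = S\<^sup>2(a) u\<close> and \<open>S(\<alpha>) u = \<gamma>\<close>. The hexagon axiom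
  gives \<open>(\<epsilon> \<otimes> \<epsilon>)(R) = 1\<close>, whence \<open>\<epsilon>(v) = 1\<close>. Now insert
  \<open>\<Delta>(v) = R'R(v \<otimes> v)\<close> into \<open>S(v\<^sub>1) \<alpha> v\<^sub>2 = \<epsilon>(v) \<alpha> = \<alpha>\<close>: the factor R'
  turns \<open>\<alpha>\<close> into \<open>\<gamma> = S(\<alpha>) u\<close>, the factor R turns this into
  \<open>S(\<gamma>) u = S(u) S\<^sup>2(\<alpha>) u = S(u) u \<alpha>\<close>, and \<open>v\<^sup>2 S(u) u \<alpha> = \<alpha>\<close> results.
  As \<open>v\<^sup>2 S(u) u\<close> is central and
  \<open>\<Sum> X \<beta> S(Y) \<alpha> Z = 1\<close>, it follows that \<open>v\<^sup>2 S(u) u = 1\<close>.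
\<close>

named_theorems lin_intros

section \<open>Tensor powers\<close>

context k_algebra
begin

section \<open>Formal sums and homogeneity\<close>

lemma vs_scale: "vector_space scale"
  by unfold_locales

lemma lin_ext_cong:
  "(\<And>w. w \<in> Poly_Mapping.keys x \<Longrightarrow> F w = G w) \<Longrightarrow> lin_ext sc x F = lin_ext sc x G"
  by (simp add: lin_ext_def)

lemma lin_ext_sum:
  assumes "vector_space sc"
  shows "lin_ext sc (lin_ext fscale x G) F = lin_ext sc x (\<lambda>v. lin_ext sc (G v) F)"
proof -
  interpret L: Vector_Spaces.linear fscale sc "\<lambda>x. lin_ext sc x F"
    by (rule lin_ext_linear[OF assms])
  show ?thesis
    by (simp add: lin_ext_def[of fscale] lin_ext_def[of sc x] L.sum L.scale)
qed

lemma lin_ext_tsum: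
  "vector_space sc \<Longrightarrow>
    lin_ext sc (tsum fscale X G) F = tsum sc X (\<lambda>v. lin_ext sc (G v) F)"
  by (simp add: tsum_def lin_ext_sum)

lemma lin_ext_fscale_word: "lin_ext fscale x word = (x :: ('a, 'k) formal)"
proof (rule poly_mapping_eqI)
  fix w
  have lookup_sum: "Poly_Mapping.lookup (sum f A) w = (\<Sum>a\<in>A. Poly_Mapping.lookup (f a) w)"
    for f :: "'a list \<Rightarrow> ('a, 'k) formal" and A
    by (induction A rule: infinite_finite_induct) (simp_all add: lookup_add)
  show "Poly_Mapping.lookup (lin_ext fscale x word) w = Poly_Mapping.lookup x w"
    by (auto simp: lin_ext_def lookup_sum word_def lookup_single when_def if_distrib in_keys_iff
        cong: if_cong)
qed

lemma keys_lin_ext: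
  assumes "w \<in> Poly_Mapping.keys (lin_ext fscale x G)"
  obtains v where "v \<in> Poly_Mapping.keys x" "w \<in> Poly_Mapping.keys (G v)"
proof -
  have "w \<in> (\<Union>v\<in>Poly_Mapping.keys x.
      Poly_Mapping.keys (fscale (Poly_Mapping.lookup x v) (G v)))"
    using assms Poly_Mapping.keys_sum unfolding lin_ext_def by fast
  then show thesis using that by (auto simp: in_keys_iff)
qed

lemma keys_word [simp]: "Poly_Mapping.keys (word w :: ('a, 'k) formal) = {w}"
  by (simp add: word_def)

text \<open>\<open>tclass n\<close> puts no constraint on word lengths, while \<open>map2\<close>
  truncates to the shorter word. Products are therefore controlled only for sums supported on words
  of length n; \<open>tensor_power n\<close> consists of the classes of such sums.\<close>

definition homog :: "nat \<Rightarrow> ('a, 'k) formal \<Rightarrow> bool"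
  where "homog n x \<longleftrightarrow> (\<forall>w\<in>Poly_Mapping.keys x. length w = n)"

lemma homog_word: "homog n (word w) \<longleftrightarrow> length w = n"
  by (simp add: homog_def)

lemma homog_lin_ext:
  assumes "\<And>w. w \<in> Poly_Mapping.keys x \<Longrightarrow> homog n (G w)"
  shows "homog n (lin_ext fscale x G)"
  unfolding homog_def
proof
  fix w assume "w \<in> Poly_Mapping.keys (lin_ext fscale x G)"
  then obtain v where "v \<in> Poly_Mapping.keys x" "w \<in> Poly_Mapping.keys (G v)"
    by (rule keys_lin_ext)
  with assms show "length w = n" by (simp add: homog_def)
qed

lemma homog_add: "homog n x \<Longrightarrow> homog n y \<Longrightarrow> homog n (x + y)"
  using Poly_Mapping.keys_add[of x y] by (auto simp: homog_def)

lemma homog_diff: "homog n x \<Longrightarrow> homog n y \<Longrightarrow> homog n (x - y)"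
  using Poly_Mapping.keys_diff[of x y] by (auto simp: homog_def)

lemma homog_fscale: "homog n x \<Longrightarrow> homog n (fscale c x)"
  by (auto simp: homog_def in_keys_iff)

text \<open>The relators involve only words of length n. Hence every member of a class in
  \<open>tensor_power n\<close> is homogeneous, in particular the representative picked by
  \<open>trep\<close>.\<close>

lemma homog_null_tensors:
  assumes "x \<in> null_tensors n"
  shows "homog n x"
proof -
  interpret P: vector_space "fscale :: 'k \<Rightarrow> ('a, 'k) formal \<Rightarrow> _" by (rule vector_space_fscale)
  have "P.span (relators n) \<subseteq> {x. homog n x}"
  proof (rule P.span_minimal)
    show "relators n \<subseteq> {x. homog n x}"
      by (auto simp: relators_def intro!: homog_diff homog_fscale simp: homog_word)
    show "P.subspace {x. homog n x}"
      by (auto simp: P.subspace_def homog_add homog_fscale) (simp add: homog_def)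
  qed
  with assms show ?thesis by (auto simp: null_tensors_def)
qed

section \<open>Classes and chosen representatives\<close>

lemma subspace_null_tensors: "module.subspace fscale (null_tensors n)"
proof -
  interpret P: vector_space "fscale :: 'k \<Rightarrow> ('a, 'k) formal \<Rightarrow> _" by (rule vector_space_fscale)
  show ?thesis by (simp add: null_tensors_def P.subspace_span)
qed

lemma tclass_eq_iff: "tclass n x = tclass n y \<longleftrightarrow> x - y \<in> null_tensors n"
proof -
  interpret P: vector_space "fscale :: 'k \<Rightarrow> ('a, 'k) formal \<Rightarrow> _" by (rule vector_space_fscale)
  note sub = subspace_null_tensors[of n]
  show ?thesis
  proof
    assume "tclass n x = tclass n y"
    moreover have "x \<in> tclass n x"
      by (simp add: tclass_def P.subspace_0[OF sub])
    ultimately show "x - y \<in> null_tensors n" by (simp add: tclass_def)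
  next
    assume d: "x - y \<in> null_tensors n"
    have "z - x \<in> null_tensors n \<longleftrightarrow> z - y \<in> null_tensors n" for z
      using P.subspace_add[OF sub _ d, of "z - x"] P.subspace_diff[OF sub _ d, of "z - y"] by auto
    then show "tclass n x = tclass n y" by (simp add: tclass_def)
  qed
qed

lemma trep_tclass: "trep (tclass n x) - x \<in> null_tensors n"
proof -
  interpret P: vector_space "fscale :: 'k \<Rightarrow> ('a, 'k) formal \<Rightarrow> _" by (rule vector_space_fscale)
  have "x \<in> tclass n x"
    by (simp add: tclass_def P.subspace_0[OF subspace_null_tensors])
  then have "trep (tclass n x) \<in> tclass n x"
    unfolding trep_def by (rule someI)
  then show ?thesis by (simp add: tclass_def)
qed

lemma tclass_trep: "X \<in> tensor_power n \<Longrightarrow> tclass n (trep X) = X"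
  by (clarsimp simp: tensor_power_def) (simp only: tclass_eq_iff trep_tclass)

lemma homog_trep:
  assumes "X \<in> tensor_power n"
  shows "homog n (trep X)"
proof -
  obtain x where x: "X = tclass n x" "homog n x"
    using assms by (auto simp: tensor_power_def homog_def)
  then show ?thesis
    using homog_add[OF homog_null_tensors[OF trep_tclass[of n x]] x(2)] by simp
qed

lemma length_trep: "X \<in> tensor_power n \<Longrightarrow> w \<in> Poly_Mapping.keys (trep X) \<Longrightarrow> length w = n"
  using homog_trep by (auto simp: homog_def)

lemma tclass_in_tensor_power: "homog n x \<Longrightarrow> tclass n x \<in> tensor_power n"
  by (auto simp: tensor_power_def homog_def)

lemma homog_tsum:
  assumes "X \<in> tensor_power n" "\<And>w. length w = n \<Longrightarrow> homog m (G w)"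
  shows "homog m (tsum fscale X G)"
  unfolding tsum_def by (rule homog_lin_ext) (use assms length_trep in blast)

lemma tmult_closed:
  "X \<in> tensor_power n \<Longrightarrow> Y \<in> tensor_power n \<Longrightarrow> tmult n X Y \<in> tensor_power n"
  unfolding tmult_def by (intro tclass_in_tensor_power homog_tsum) (auto simp: homog_word)

lemma tone_closed: "tone n \<in> tensor_power n"
  by (simp add: tone_def tpure_def tclass_in_tensor_power homog_word)

lemma tpure_closed: "tpure w \<in> tensor_power (length w)"
  by (simp add: tpure_def tclass_in_tensor_power homog_word)

lemma tflip_closed: "X \<in> tensor_power 2 \<Longrightarrow> tflip X \<in> tensor_power 2"
  unfolding tflip_def tsum2_def
  by (intro tclass_in_tensor_power homog_tsum) (auto simp: homog_word)

lemma one_tensor_closed: "X \<in> tensor_power n \<Longrightarrow> one_tensor n X \<in> tensor_power (Suc n)"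
  unfolding one_tensor_def Suc_eq_plus1
  by (intro tclass_in_tensor_power homog_tsum) (auto simp: homog_word)

lemma tensor_one_closed: "X \<in> tensor_power n \<Longrightarrow> tensor_one n X \<in> tensor_power (Suc n)"
  unfolding tensor_one_def Suc_eq_plus1
  by (intro tclass_in_tensor_power homog_tsum) (auto simp: homog_word)

lemma comult_at_closed:
  assumes "X \<in> tensor_power n" "i < n" "\<And>a. \<Delta> a \<in> tensor_power 2"
  shows "comult_at \<Delta> n i X \<in> tensor_power (Suc n)"
  unfolding comult_at_def Suc_eq_plus1
  by (intro tclass_in_tensor_power homog_tsum[where m = "n + 1"] assms)
    (use assms in \<open>auto simp: homog_word\<close>)

section \<open>The algebra structure of a tensor power\<close>

lemma null_tensorsI:
  assumes "length p + 1 + length q = n"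
  shows "word (p @ (a + b) # q) - word (p @ a # q) - word (p @ b # q) \<in> null_tensors n"
    and "word (p @ (c *s a) # q) - fscale c (word (p @ a # q)) \<in> null_tensors n"
proof -
  interpret P: vector_space "fscale :: 'k \<Rightarrow> ('a, 'k) formal \<Rightarrow> _" by (rule vector_space_fscale)
  show "word (p @ (a + b) # q) - word (p @ a # q) - word (p @ b # q) \<in> null_tensors n"
    "word (p @ (c *s a) # q) - fscale c (word (p @ a # q)) \<in> null_tensors n"
    unfolding null_tensors_def relators_def using assms by (intro P.span_base; blast)+
qed

text \<open>Cutting the other word at the position of the varied letter brings the product into the
  shape \<open>p @ a # q\<close> found in the relators.\<close>

lemma map2_append_Cons:
  assumes "length p + 1 + length q = length w"
  shows "map2 f (p @ a # q) w =
      map2 f p (take (length p) w) @ f a (w ! length p) # map2 f q (drop (length p + 1) w)"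
    and "map2 f w (p @ a # q) =
      map2 f (take (length p) w) p @ f (w ! length p) a # map2 f (drop (length p + 1) w) q"
proof -
  define w\<^sub>1 c w\<^sub>2 where "w\<^sub>1 = take (length p) w" and "c = w ! length p"
    and "w\<^sub>2 = drop (length p + 1) w"
  have "w = w\<^sub>1 @ c # w\<^sub>2"
    using assms by (simp add: w\<^sub>1_def c_def w\<^sub>2_def id_take_nth_drop)
  moreover have "length w\<^sub>1 = length p" using assms by (simp add: w\<^sub>1_def)
  ultimately have "map2 f (p @ a # q) w = map2 f p w\<^sub>1 @ f a c # map2 f q w\<^sub>2"
    "map2 f w (p @ a # q) = map2 f w\<^sub>1 p @ f c a # map2 f w\<^sub>2 q"
    by simp_all
  then show "map2 f (p @ a # q) w =
      map2 f p (take (length p) w) @ f a (w ! length p) # map2 f q (drop (length p + 1) w)"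
    "map2 f w (p @ a # q) =
      map2 f (take (length p) w) p @ f (w ! length p) a # map2 f (drop (length p + 1) w) q"
    by (simp_all only: w\<^sub>1_def c_def w\<^sub>2_def)
qed

lemma multilinear_map2_left:
  "length w = n \<Longrightarrow> multilinear_mod fscale (null_tensors n) n (\<lambda>v. word (map2 (*) v w))"
  unfolding multilinear_mod_def
  by (simp add: map2_append_Cons distrib_right scale_mult_left null_tensorsI)

lemma multilinear_map2_right:
  "length v = n \<Longrightarrow> multilinear_mod fscale (null_tensors n) n (\<lambda>w. word (map2 (*) v w))"
  unfolding multilinear_mod_def
  by (simp add: map2_append_Cons distrib_left scale_mult_right null_tensorsI)

lemma lin_ext_diff:
  assumes "vector_space sc"
  shows "lin_ext sc x (\<lambda>w. F w - G w) = lin_ext sc x F - lin_ext sc x G"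
proof -
  interpret V: vector_space sc by fact
  show ?thesis by (simp add: lin_ext_def V.scale_right_diff_distrib sum_subtractf)
qed

lemma lin_ext_scale:
  assumes "vector_space sc"
  shows "lin_ext sc x (\<lambda>w. sc c (F w)) = sc c (lin_ext sc x F)"
proof -
  interpret V: vector_space sc by fact
  show ?thesis by (simp add: lin_ext_def V.scale_sum_right mult.commute)
qed

lemma lin_ext_in_subspace:
  assumes "vector_space sc" "module.subspace sc U"
    and "\<And>w. w \<in> Poly_Mapping.keys x \<Longrightarrow> F w \<in> U"
  shows "lin_ext sc x F \<in> U"
proof -
  interpret V: vector_space sc by fact
  show ?thesis
    unfolding lin_ext_def using assms by (intro V.subspace_sum V.subspace_scale) auto
qed

text \<open>The product before passing to classes. Associativity, and the unit law for homogeneous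
  sums, are here plain equations of formal sums, since letterwise multiplication of words satisfies
  them.\<close>

definition fmult :: "('a, 'k) formal \<Rightarrow> ('a, 'k) formal \<Rightarrow> ('a, 'k) formal"
  where "fmult x y = lin_ext fscale x (\<lambda>v. lin_ext fscale y (\<lambda>w. word (map2 (*) v w)))"

lemma homog_fmult: "homog n x \<Longrightarrow> homog n y \<Longrightarrow> homog n (fmult x y)"
  unfolding fmult_def by (intro homog_lin_ext) (auto simp: homog_def)

lemma fmult_diff_left: "fmult (x - x') y = fmult x y - fmult x' y"
proof -
  interpret L: Vector_Spaces.linear fscale fscale
    "\<lambda>x. lin_ext fscale x (\<lambda>v. lin_ext fscale y (\<lambda>w. word (map2 (*) v w)))"
    by (rule lin_ext_linear[OF vector_space_fscale])
  show ?thesis by (simp add: fmult_def L.diff)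
qed

lemma fmult_diff_right: "fmult x (y - y') = fmult x y - fmult x y'"
proof -
  have "lin_ext fscale (y - y') (\<lambda>w. word (map2 (*) v w)) =
      lin_ext fscale y (\<lambda>w. word (map2 (*) v w)) - lin_ext fscale y' (\<lambda>w. word (map2 (*) v w))" for v
  proof -
    interpret L: Vector_Spaces.linear fscale fscale
      "\<lambda>y. lin_ext fscale y (\<lambda>w. word (map2 (*) v w))"
      by (rule lin_ext_linear[OF vector_space_fscale])
    show ?thesis by (rule L.diff)
  qed
  then show ?thesis by (simp add: fmult_def lin_ext_diff[OF vector_space_fscale])
qed

text \<open>For a fixed word of length n the letterwise product is multilinear in the other word
  modulo null tensors, and linear combinations keep this. Homogeneity of y supplies the
  length.\<close>

lemma fmult_null_left:
  assumes "x \<in> null_tensors n" "homog n y"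
  shows "fmult x y \<in> null_tensors n"
  unfolding fmult_def
proof (rule lin_ext_null[OF vector_space_fscale subspace_null_tensors _ assms(1)])
  have ml: "multilinear_mod fscale (null_tensors n) n (\<lambda>v. word (map2 (*) v w))"
    if "w \<in> Poly_Mapping.keys y" for w
    using assms(2) that by (intro multilinear_map2_left) (auto simp: homog_def)
  show "multilinear_mod fscale (null_tensors n) n
     (\<lambda>v. lin_ext fscale y (\<lambda>w. word (map2 (*) v w)))"
    unfolding multilinear_mod_def
  proof (intro allI impI conjI)
    fix p q :: "'a list" and a b c
    assume pq: "length p + 1 + length q = n"
    note in_null = lin_ext_in_subspace[OF vector_space_fscale subspace_null_tensors]
    let ?m = "\<lambda>v. lin_ext fscale y (\<lambda>w. word (map2 (*) v w))"
    have "lin_ext fscale y (\<lambda>w. word (map2 (*) (p @ (a + b) # q) w)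
        - word (map2 (*) (p @ a # q) w) - word (map2 (*) (p @ b # q) w)) \<in> null_tensors n"
      by (rule in_null) (use ml pq in \<open>simp add: multilinear_mod_def\<close>)
    then show "?m (p @ (a + b) # q) - ?m (p @ a # q) - ?m (p @ b # q) \<in> null_tensors n"
      by (simp only: lin_ext_diff[OF vector_space_fscale])
    have "lin_ext fscale y (\<lambda>w. word (map2 (*) (p @ (c *s a) # q) w)
        - fscale c (word (map2 (*) (p @ a # q) w))) \<in> null_tensors n"
      by (rule in_null) (use ml pq in \<open>simp add: multilinear_mod_def\<close>)
    then show "?m (p @ (c *s a) # q) - fscale c (?m (p @ a # q)) \<in> null_tensors n"
      by (simp only: lin_ext_diff[OF vector_space_fscale] lin_ext_scale[OF vector_space_fscale])
  qed
qed

lemma fmult_null_right: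
  assumes "homog n x" "y \<in> null_tensors n"
  shows "fmult x y \<in> null_tensors n"
  unfolding fmult_def
proof (rule lin_ext_in_subspace[OF vector_space_fscale subspace_null_tensors])
  fix v assume "v \<in> Poly_Mapping.keys x"
  then have "length v = n" using assms(1) by (simp add: homog_def)
  then show "lin_ext fscale y (\<lambda>w. word (map2 (*) v w)) \<in> null_tensors n"
    by (intro lin_ext_null[OF vector_space_fscale subspace_null_tensors _ assms(2)]
        multilinear_map2_right)
qed

lemma tmult_tclass:
  assumes "homog n x" "homog n y"
  shows "tmult n (tclass n x) (tclass n y) = tclass n (fmult x y)"
proof -
  interpret P: vector_space "fscale :: 'k \<Rightarrow> ('a, 'k) formal \<Rightarrow> _" by (rule vector_space_fscale)
  let ?x = "trep (tclass n x)" and ?y = "trep (tclass n y)"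
  have "homog n ?x" by (intro homog_trep tclass_in_tensor_power assms)
  \<comment> \<open>Representatives are exchanged one factor at a time. The second summand uses that
    the chosen \<open>?x\<close>, and not only x, is homogeneous.\<close>
  then have "fmult (?x - x) y + fmult ?x (?y - y) \<in> null_tensors n"
    by (intro P.subspace_add[OF subspace_null_tensors] fmult_null_left fmult_null_right
        trep_tclass assms)
  then have "fmult ?x ?y - fmult x y \<in> null_tensors n"
    by (simp add: fmult_diff_left fmult_diff_right algebra_simps)
  then show ?thesis
    by (simp add: tmult_def tsum_def tclass_eq_iff fmult_def)
qed

lemma map2_mult_assoc: "map2 (*) (map2 (*) u v) w = map2 (*) u (map2 (*) v (w :: 'a list))"
  by (rule nth_equalityI) (auto simp: mult.assoc)

lemma fmult_assoc: "fmult (fmult x y) z = fmult x (fmult y z)"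
  by (simp add: fmult_def lin_ext_sum[OF vector_space_fscale] lin_ext_word[OF vector_space_fscale]
      map2_mult_assoc)

lemma tmult_assoc:
  assumes "X \<in> tensor_power n" "Y \<in> tensor_power n" "Z \<in> tensor_power n"
  shows "tmult n (tmult n X Y) Z = tmult n X (tmult n Y Z)"
proof -
  have "tmult n (tmult n (tclass n (trep X)) (tclass n (trep Y))) (tclass n (trep Z))
      = tmult n (tclass n (trep X)) (tmult n (tclass n (trep Y)) (tclass n (trep Z)))"
    by (simp only: tmult_tclass homog_trep homog_fmult fmult_assoc assms)
  then show ?thesis by (simp only: tclass_trep assms)
qed

lemma map2_replicate_one:
  "length w = n \<Longrightarrow> map2 (*) w (replicate n 1) = (w :: 'a list)"
  "length w = n \<Longrightarrow> map2 (*) (replicate n 1) w = (w :: 'a list)"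
  by (rule nth_equalityI; simp)+

lemma fmult_one:
  assumes "homog n x"
  shows "fmult x (word (replicate n 1)) = x" "fmult (word (replicate n 1)) x = x"
proof -
  have len: "length w = n" if "w \<in> Poly_Mapping.keys x" for w
    using assms that by (simp add: homog_def)
  have "fmult x (word (replicate n 1)) = lin_ext fscale x word"
    unfolding fmult_def lin_ext_word[OF vector_space_fscale]
    by (rule lin_ext_cong) (simp only: map2_replicate_one len)
  moreover have "fmult (word (replicate n 1)) x = lin_ext fscale x word"
    unfolding fmult_def lin_ext_word[OF vector_space_fscale]
    by (rule lin_ext_cong) (simp only: map2_replicate_one len)
  ultimately show "fmult x (word (replicate n 1)) = x" "fmult (word (replicate n 1)) x = x"
    by (simp_all only: lin_ext_fscale_word)
qed

lemma tmult_tone: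
  assumes "X \<in> tensor_power n"
  shows "tmult n X (tone n) = X" "tmult n (tone n) X = X"
proof -
  have "tmult n (tclass n (trep X)) (tone n) = tclass n (trep X)"
    "tmult n (tone n) (tclass n (trep X)) = tclass n (trep X)"
    by (simp_all only: tone_def tpure_def length_replicate tmult_tclass homog_trep assms
        homog_word fmult_one)
  then show "tmult n X (tone n) = X" "tmult n (tone n) X = X"
    by (simp_all only: tclass_trep assms)
qed

text \<open>Two-sided inverses in an associative algebra with unit are unique, so the definite
  description in \<open>tinv\<close> denotes the existing inverse.\<close>

lemma is_tinverse_tinv:
  assumes "tinvertible n X"
  shows "is_tinverse n X (tinv n X)"
proof -
  obtain Y where X: "X \<in> tensor_power n" and Y: "is_tinverse n X Y"
    using assms by (auto simp: tinvertible_def)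
  have "Y' = Y" if "is_tinverse n X Y'" for Y'
    using tmult_assoc[of Y' n X Y] X Y that by (simp add: is_tinverse_def tmult_tone)
  then show ?thesis
    unfolding tinv_def using Y by (intro theI[of "is_tinverse n X"])
qed

end

section \<open>Evaluating multilinear maps on tensors\<close>

context k_algebra
begin

section \<open>Linear maps and Sweedler sums\<close>

definition lin :: "('a \<Rightarrow> 'a) \<Rightarrow> bool"
  where "lin f \<longleftrightarrow> (\<forall>a b. f (a + b) = f a + f b) \<and> (\<forall>c a. f (c *s a) = c *s f a)"

lemma lin_scale: "lin f \<Longrightarrow> f (c *s a) = c *s f a"
  by (simp add: lin_def)

text \<open>The sum is a finite linear combination over one fixed representative, so f passes
  through it for arbitrary summands; multilinearity matters only when the representative
  changes.\<close>

lemma lin_tsum: "lin f \<Longrightarrow> f (tsum scale X F) = tsum scale X (\<lambda>w. f (F w))"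
proof -
  assume f: "lin f"
  then interpret f: Vector_Spaces.linear scale scale f
    by unfold_locales (auto simp: lin_def scale_right_distrib scale_left_distrib)
  show ?thesis by (simp add: tsum_def lin_ext_def f.sum f.scale)
qed

lemma lin_id: "lin (\<lambda>x. x)"
  by (simp add: lin_def)

lemma lin_mult_left: "lin f \<Longrightarrow> lin (\<lambda>x. f x * b)"
  by (simp add: lin_def distrib_right scale_mult_left)

lemma lin_mult_right: "lin f \<Longrightarrow> lin (\<lambda>x. a * f x)"
  by (simp add: lin_def distrib_left scale_mult_right)

lemma lin_scale_right: "lin f \<Longrightarrow> lin (\<lambda>x. c *s f x)"
  by (simp add: lin_def scale_right_distrib mult.commute)

lemma lin_tsum_right: "(\<And>w. lin (F w)) \<Longrightarrow> lin (\<lambda>x. tsum scale X (\<lambda>w. F w x))"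
  by (simp add: lin_def tsum_def lin_ext_def scale_right_distrib sum.distrib scale_sum_right
      mult.commute)

definition tsum4 ::
    "('k \<Rightarrow> 'v \<Rightarrow> 'v::ab_group_add) \<Rightarrow> ('a, 'k) tensor \<Rightarrow> ('a \<Rightarrow> 'a \<Rightarrow> 'a \<Rightarrow> 'a \<Rightarrow> 'v) \<Rightarrow> 'v"
  where "tsum4 sc X F = tsum sc X (\<lambda>w. F (w ! 0) (w ! 1) (w ! 2) (w ! 3))"

lemma lin_tsum2: "lin f \<Longrightarrow> f (tsum2 scale X F) = tsum2 scale X (\<lambda>a b. f (F a b))"
  and lin_tsum3: "lin f \<Longrightarrow> f (tsum3 scale X G) = tsum3 scale X (\<lambda>a b c. f (G a b c))"
  by (simp_all add: tsum2_def tsum3_def lin_tsum)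

lemma lin_tsum2_right: "(\<And>a b. lin (F a b)) \<Longrightarrow> lin (\<lambda>x. tsum2 scale X (\<lambda>a b. F a b x))"
  and lin_tsum3_right:
    "(\<And>a b c. lin (G a b c)) \<Longrightarrow> lin (\<lambda>x. tsum3 scale X (\<lambda>a b c. G a b c x))"
  by (simp_all add: tsum2_def tsum3_def lin_tsum_right)

lemma tsum2_mult_right: "a * tsum2 scale X F = tsum2 scale X (\<lambda>x y. a * F x y)"
  and tsum3_mult_right: "a * tsum3 scale X G = tsum3 scale X (\<lambda>x y z. a * G x y z)"
  by (simp_all add: lin_tsum2 lin_tsum3 lin_mult_right lin_id)

lemma tsum2_mult_left: "tsum2 scale X F * a = tsum2 scale X (\<lambda>x y. F x y * a)"
  and tsum3_mult_left: "tsum3 scale X G * a = tsum3 scale X (\<lambda>x y z. G x y z * a)"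
  using lin_tsum2[OF lin_mult_left[OF lin_id], of X F a]
    lin_tsum3[OF lin_mult_left[OF lin_id], of X G a] by simp_all

lemma tsum2_scale: "tsum2 scale X (\<lambda>x y. c *s F x y) = c *s tsum2 scale X F"
  and tsum3_scale: "tsum3 scale X (\<lambda>x y z. c *s G x y z) = c *s tsum3 scale X G"
  by (simp_all add: lin_tsum2 lin_tsum3 lin_scale_right lin_id)

section \<open>Multilinear maps on two, three and four factors\<close>

definition bilin :: "('a \<Rightarrow> 'a \<Rightarrow> 'a) \<Rightarrow> bool"
  where "bilin f \<longleftrightarrow> (\<forall>b. lin (\<lambda>a. f a b)) \<and> (\<forall>a. lin (\<lambda>b. f a b))"

definition trilin :: "('a \<Rightarrow> 'a \<Rightarrow> 'a \<Rightarrow> 'a) \<Rightarrow> bool"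
  where "trilin f \<longleftrightarrow> (\<forall>b c. lin (\<lambda>a. f a b c)) \<and> (\<forall>a c. lin (\<lambda>b. f a b c)) \<and>
    (\<forall>a b. lin (\<lambda>c. f a b c))"

definition quadlin :: "('a \<Rightarrow> 'a \<Rightarrow> 'a \<Rightarrow> 'a \<Rightarrow> 'a) \<Rightarrow> bool"
  where "quadlin f \<longleftrightarrow> (\<forall>b c d. lin (\<lambda>a. f a b c d)) \<and> (\<forall>a c d. lin (\<lambda>b. f a b c d)) \<and>
    (\<forall>a b d. lin (\<lambda>c. f a b c d)) \<and> (\<forall>a b c. lin (\<lambda>d. f a b c d))"

lemma bilinI: "(\<And>b. lin (\<lambda>a. f a b)) \<Longrightarrow> (\<And>a. lin (\<lambda>b. f a b)) \<Longrightarrow> bilin f"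
  by (simp add: bilin_def)

lemma trilinI: "(\<And>b c. lin (\<lambda>a. f a b c)) \<Longrightarrow> (\<And>a c. lin (\<lambda>b. f a b c)) \<Longrightarrow>
    (\<And>a b. lin (\<lambda>c. f a b c)) \<Longrightarrow> trilin f"
  by (simp add: trilin_def)

lemma quadlinI: "(\<And>b c d. lin (\<lambda>a. f a b c d)) \<Longrightarrow> (\<And>a c d. lin (\<lambda>b. f a b c d)) \<Longrightarrow>
    (\<And>a b d. lin (\<lambda>c. f a b c d)) \<Longrightarrow> (\<And>a b c. lin (\<lambda>d. f a b c d)) \<Longrightarrow> quadlin f"
  by (simp add: quadlin_def)

text \<open>A relator varies one letter; its possible positions correspond to the clauses of
  \<open>bilin\<close>, and in the lemmas below to those of \<open>trilin\<close> and
  \<open>quadlin\<close>.\<close>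

lemma split_length_2:
  assumes "length p + 1 + length q = 2"
  obtains x where "p = []" "q = [x]" | x where "p = [x]" "q = []"
  using assms by (cases p; cases q) auto

lemma split_length_3:
  assumes "length p + 1 + length q = 3"
  obtains x y where "p = []" "q = [x, y]" | x y where "p = [x]" "q = [y]"
    | x y where "p = [x, y]" "q = []"
proof (cases p)
  case Nil
  with assms that(1) show thesis by (cases q; cases "tl q") auto
next
  case (Cons x p')
  with assms have "length p' + 1 + length q = 2" by simp
  then show thesis by (cases rule: split_length_2) (use Cons that in auto)
qed

lemma split_length_4:
  assumes "length p + 1 + length q = 4"
  obtains x y z where "p = []" "q = [x, y, z]" | x y z where "p = [x]" "q = [y, z]"
    | x y z where "p = [x, y]" "q = [z]" | x y z where "p = [x, y, z]" "q = []"
proof (cases p)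
  case Nil
  with assms have "length (tl q) + 1 + 0 = 3" "q \<noteq> []" by auto
  then obtain x y z where "q = [x, y, z]"
    by (cases q; cases "tl q"; cases "tl (tl q)") auto
  with Nil that(1) show thesis by auto
next
  case (Cons x p')
  with assms have "length p' + 1 + length q = 3" by simp
  then show thesis by (cases rule: split_length_3) (use Cons that in auto)
qed

lemma multilinear_mod_2:
  assumes "bilin f"
  shows "multilinear_mod scale {0} 2 (\<lambda>w. f (w ! 0) (w ! 1))"
  unfolding multilinear_mod_def
  by (intro allI impI, erule split_length_2)
    (use assms in \<open>simp_all add: bilin_def lin_def\<close>)

lemma multilinear_mod_3:
  assumes "trilin f"
  shows "multilinear_mod scale {0} 3 (\<lambda>w. f (w ! 0) (w ! 1) (w ! 2))"
  unfolding multilinear_mod_def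
  by (intro allI impI, erule split_length_3)
    (use assms in \<open>simp_all add: trilin_def lin_def\<close>)

lemma multilinear_mod_4:
  assumes "quadlin f"
  shows "multilinear_mod scale {0} 4 (\<lambda>w. f (w ! 0) (w ! 1) (w ! 2) (w ! 3))"
  unfolding multilinear_mod_def
  by (intro allI impI, erule split_length_4)
    (use assms in \<open>simp_all add: quadlin_def lin_def\<close>)

text \<open>With \<open>{0}\<close> as the subspace, \<open>tsum_well_defined\<close> says that the
  chosen representative and x give the same value.\<close>

lemma tsum_tclass:
  assumes "multilinear_mod scale {0} n F"
  shows "tsum scale (tclass n x) F = lin_ext scale x F"
proof -
  have "tsum scale (tclass n x) F - lin_ext scale x F \<in> {0}"
    by (rule tsum_well_defined[OF vs_scale _ assms]) (rule subspace_single_0)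
  then show ?thesis by simp
qed

lemma tsum_cong:
  "X \<in> tensor_power n \<Longrightarrow> (\<And>w. length w = n \<Longrightarrow> F w = G w) \<Longrightarrow> tsum sc X F = tsum sc X G"
  unfolding tsum_def using length_trep by (intro lin_ext_cong) blast

lemma tsum2_tclass:
  "bilin f \<Longrightarrow> tsum2 scale (tclass 2 x) f = lin_ext scale x (\<lambda>w. f (w ! 0) (w ! 1))"
  unfolding tsum2_def by (rule tsum_tclass[OF multilinear_mod_2])

lemma tsum3_tclass:
  "trilin f \<Longrightarrow>
    tsum3 scale (tclass 3 x) f = lin_ext scale x (\<lambda>w. f (w ! 0) (w ! 1) (w ! 2))"
  unfolding tsum3_def by (rule tsum_tclass[OF multilinear_mod_3])

lemma tsum4_tclass:
  "quadlin f \<Longrightarrow>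
    tsum4 scale (tclass 4 x) f = lin_ext scale x (\<lambda>w. f (w ! 0) (w ! 1) (w ! 2) (w ! 3))"
  unfolding tsum4_def by (rule tsum_tclass[OF multilinear_mod_4])

lemma lin_ext_tsum2:
  "lin_ext scale (tsum2 fscale X G) F = tsum2 scale X (\<lambda>a b. lin_ext scale (G a b) F)"
  by (simp add: tsum2_def lin_ext_tsum[OF vs_scale])

lemma lin_ext_tsum3:
  "lin_ext scale (tsum3 fscale X G) F = tsum3 scale X (\<lambda>a b c. lin_ext scale (G a b c) F)"
  by (simp add: tsum3_def lin_ext_tsum[OF vs_scale])

lemma length_2_cases: "length w = 2 \<Longrightarrow> w = [w ! 0, w ! 1]"
  by (auto simp: length_Suc_conv numeral_2_eq_2)

lemma length_3_cases: "length w = 3 \<Longrightarrow> w = [w ! 0, w ! 1, w ! 2]"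
  by (auto simp: length_Suc_conv numeral_3_eq_3 numeral_2_eq_2)

text \<open>All words of the chosen representative have length two, hence are determined by their
  two letters. This also serves when F yields formal sums.\<close>

lemma tsum_words_2:
  "X \<in> tensor_power 2 \<Longrightarrow> tsum sc X F = tsum2 sc X (\<lambda>a b. F [a, b])"
  unfolding tsum2_def by (rule tsum_cong) (auto dest: length_2_cases)

lemma tsum_words_3:
  "X \<in> tensor_power 3 \<Longrightarrow> tsum sc X F = tsum3 sc X (\<lambda>a b c. F [a, b, c])"
  unfolding tsum3_def by (rule tsum_cong) (auto dest: length_3_cases)

text \<open>Evaluation of an operation that ends in a class: multilinearity replaces the class by
  its defining formal sum, the outer evaluation is pushed into nested formal sums, and finally
  single words are evaluated.\<close>

lemmas tsum_eval =
  tsum2_tclass tsum3_tclass tsum4_tclass tsum_words_2 tsum_words_3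
  lin_ext_tsum2 lin_ext_tsum3 lin_ext_word[OF vs_scale]

section \<open>Values on products, units, flips, coproducts and counits\<close>

lemma tsum_tmult:
  assumes "multilinear_mod scale {0} n F"
  shows "tsum scale (tmult n X Y) F = tsum scale X (\<lambda>v. tsum scale Y (\<lambda>w. F (map2 (*) v w)))"
  using assms
  by (simp add: tmult_def tsum_tclass lin_ext_tsum[OF vs_scale] lin_ext_word[OF vs_scale])

text \<open>Tensor axioms are used by testing them against multilinear maps into A: an equation
  between products becomes an equation between iterated sums.\<close>

lemma tsum2_tmult:
  assumes "X \<in> tensor_power 2" "Y \<in> tensor_power 2" "bilin f"
  shows "tsum2 scale (tmult 2 X Y) f =
    tsum2 scale X (\<lambda>a b. tsum2 scale Y (\<lambda>c d. f (a * c) (b * d)))"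
  unfolding tsum2_def tsum_tmult[OF multilinear_mod_2[OF assms(3)]]
  by (rule tsum_cong[OF assms(1)], rule tsum_cong[OF assms(2)]) simp

lemma tsum3_tmult:
  assumes "X \<in> tensor_power 3" "Y \<in> tensor_power 3" "trilin f"
  shows "tsum3 scale (tmult 3 X Y) f =
    tsum3 scale X (\<lambda>a b c. tsum3 scale Y (\<lambda>x y z. f (a * x) (b * y) (c * z)))"
  unfolding tsum3_def tsum_tmult[OF multilinear_mod_3[OF assms(3)]]
  by (rule tsum_cong[OF assms(1)], rule tsum_cong[OF assms(2)]) simp

lemma tsum4_tmult:
  assumes "X \<in> tensor_power 4" "Y \<in> tensor_power 4" "quadlin f"
  shows "tsum4 scale (tmult 4 X Y) f =
    tsum4 scale X (\<lambda>a b c d. tsum4 scale Y (\<lambda>x y z w. f (a * x) (b * y) (c * z) (d * w)))"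
  unfolding tsum4_def tsum_tmult[OF multilinear_mod_4[OF assms(3)]]
  by (rule tsum_cong[OF assms(1)], rule tsum_cong[OF assms(2)]) simp

lemma tsum2_tpure: "bilin f \<Longrightarrow> tsum2 scale (tpure [a, b]) f = f a b"
  using tsum2_tclass[of f "word [a, b]"]
  by (simp add: tpure_def lin_ext_word[OF vs_scale] numeral_2_eq_2)

lemma tsum2_tone: "bilin f \<Longrightarrow> tsum2 scale (tone 2) f = f 1 1"
  using tsum2_tpure[of f 1 1] by (simp add: tone_def numeral_2_eq_2)

lemma tsum3_tone: "trilin f \<Longrightarrow> tsum3 scale (tone 3) f = f 1 1 1"
  using tsum3_tclass[of f "word [1, 1, 1]"]
  by (simp add: tone_def tpure_def lin_ext_word[OF vs_scale] numeral_3_eq_3)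

lemma tsum2_tflip: "bilin f \<Longrightarrow> tsum2 scale (tflip X) f = tsum2 scale X (\<lambda>a b. f b a)"
  by (simp add: tflip_def tsum_eval)

lemma tsum4_one_tensor:
  "X \<in> tensor_power 3 \<Longrightarrow> quadlin f \<Longrightarrow> tsum4 scale (one_tensor 3 X) f = tsum3 scale X (f 1)"
  by (simp add: one_tensor_def tsum_eval)

lemma tsum4_tensor_one:
  "X \<in> tensor_power 3 \<Longrightarrow> quadlin f \<Longrightarrow>
    tsum4 scale (tensor_one 3 X) f = tsum3 scale X (\<lambda>a b c. f a b c 1)"
  by (simp add: tensor_one_def tsum_eval)

lemma tsum3_comult_at:
  assumes "X \<in> tensor_power 2" "\<And>a. \<Delta> a \<in> tensor_power 2" "trilin f"
  shows "tsum3 scale (comult_at \<Delta> 2 0 X) f =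
      tsum2 scale X (\<lambda>a b. tsum2 scale (\<Delta> a) (\<lambda>x y. f x y b))"
    and "tsum3 scale (comult_at \<Delta> 2 1 X) f =
      tsum2 scale X (\<lambda>a b. tsum2 scale (\<Delta> b) (\<lambda>x y. f a x y))"
  using assms by (simp_all add: comult_at_def tsum_eval)

lemma tsum4_comult_at:
  assumes "X \<in> tensor_power 3" "\<And>a. \<Delta> a \<in> tensor_power 2" "quadlin f"
  shows "tsum4 scale (comult_at \<Delta> 3 0 X) f =
      tsum3 scale X (\<lambda>a b c. tsum2 scale (\<Delta> a) (\<lambda>x y. f x y b c))"
    and "tsum4 scale (comult_at \<Delta> 3 1 X) f =
      tsum3 scale X (\<lambda>a b c. tsum2 scale (\<Delta> b) (\<lambda>x y. f a x y c))"
    and "tsum4 scale (comult_at \<Delta> 3 2 X) f =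
      tsum3 scale X (\<lambda>a b c. tsum2 scale (\<Delta> c) (\<lambda>x y. f a b x y))"
  using assms by (simp_all add: comult_at_def tsum_eval)

lemma tsum2_counit_at:
  assumes "X \<in> tensor_power 3" "bilin f"
  shows "tsum2 scale (counit_at \<epsilon> 3 1 X) f = tsum3 scale X (\<lambda>a b c. \<epsilon> b *s f a c)"
proof -
  interpret L: Vector_Spaces.linear fscale scale "\<lambda>x. lin_ext scale x (\<lambda>w. f (w ! 0) (w ! 1))"
    by (rule lin_ext_linear[OF vs_scale])
  \<comment> \<open>\<open>counit_at\<close> leaves scaled words, which \<open>tsum_eval\<close>
    alone does not evaluate.\<close>
  have "lin_ext scale (fscale c (word [a, b])) (\<lambda>w. f (w ! 0) (w ! 1)) = c *s f a b" for c a b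
    by (simp only: L.scale lin_ext_word[OF vs_scale]) simp
  with assms show ?thesis by (simp add: counit_at_def tsum_eval)
qed

text \<open>Structural rules with which \<open>intro\<close> proves linearity in one variable of a
  composed expression. Hypotheses such as \<open>bilin f\<close> join them through
  \<open>bilin_lin\<close>, \<open>trilin_lin\<close> and \<open>quadlin_lin\<close>.\<close>

lemmas [lin_intros] = lin_id lin_mult_left lin_mult_right lin_scale_right lin_tsum2_right
  lin_tsum3_right bilinI trilinI quadlinI

lemma bilin_lin:
  "bilin f \<Longrightarrow> lin g \<Longrightarrow> lin (\<lambda>x. f (g x) b)"
  "bilin f \<Longrightarrow> lin g \<Longrightarrow> lin (\<lambda>x. f a (g x))"
  by (simp_all add: bilin_def lin_def)

lemma trilin_lin:
  "trilin f \<Longrightarrow> lin g \<Longrightarrow> lin (\<lambda>x. f (g x) b c)"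
  "trilin f \<Longrightarrow> lin g \<Longrightarrow> lin (\<lambda>x. f a (g x) c)"
  "trilin f \<Longrightarrow> lin g \<Longrightarrow> lin (\<lambda>x. f a b (g x))"
  by (simp_all add: trilin_def lin_def)

lemma quadlin_lin:
  "quadlin f \<Longrightarrow> lin g \<Longrightarrow> lin (\<lambda>x. f (g x) b c d)"
  "quadlin f \<Longrightarrow> lin g \<Longrightarrow> lin (\<lambda>x. f a (g x) c d)"
  "quadlin f \<Longrightarrow> lin g \<Longrightarrow> lin (\<lambda>x. f a b (g x) d)"
  "quadlin f \<Longrightarrow> lin g \<Longrightarrow> lin (\<lambda>x. f a b c (g x))"
  by (simp_all add: quadlin_def lin_def)

end

section \<open>Quasi-bialgebras\<close>

context quasi_bialgebra
begin

section \<open>Quasi-coassociativity and the pentagon as equations of sums\<close>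

abbreviation "sum\<^sub>\<Delta> a \<equiv> tsum2 scale (\<Delta> a)"
abbreviation "sum\<^sub>\<Phi> \<equiv> tsum3 scale \<Phi>"
abbreviation "sum\<^sub>\<Psi> \<equiv> tsum3 scale (tinv 3 \<Phi>)"

lemma counit_lin: "\<epsilon> (a + b) = \<epsilon> a + \<epsilon> b" "\<epsilon> (c *s a) = c * \<epsilon> a"
proof -
  interpret E: Vector_Spaces.linear scale "(*)" \<epsilon> by (rule counit_linear)
  show "\<epsilon> (a + b) = \<epsilon> a + \<epsilon> b" "\<epsilon> (c *s a) = c * \<epsilon> a" by (rule E.add E.scale)+
qed

lemma lin_counit [lin_intros]: "lin f \<Longrightarrow> lin (\<lambda>x. \<epsilon> (f x) *s a)"
  by (simp add: lin_def counit_lin scale_left_distrib)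

lemma counit_mult_scale: "\<epsilon> (a * b) *s x = \<epsilon> a *s \<epsilon> b *s x"
  by (simp add: counit_mult)

text \<open>\<open>comult_add\<close> and \<open>comult_scale\<close> describe \<Delta> through
  chosen representatives. Bilinearity of f allows evaluation on these, where the value is linear in
  the formal sum.\<close>

lemma lin_comult [lin_intros]:
  assumes "bilin f" "lin g"
  shows "lin (\<lambda>x. sum\<^sub>\<Delta> (g x) f)"
proof -
  interpret F: Vector_Spaces.linear fscale scale "\<lambda>x. lin_ext scale x (\<lambda>w. f (w ! 0) (w ! 1))"
    by (rule lin_ext_linear[OF vs_scale])
  have eq: "lin_ext scale (trep X) (\<lambda>w. f (w ! 0) (w ! 1)) = tsum2 scale X f" for X
    by (simp add: tsum2_def tsum_def)
  have "sum\<^sub>\<Delta> (a + b) f = sum\<^sub>\<Delta> a f + sum\<^sub>\<Delta> b f" for a b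
    unfolding comult_add tadd_def tsum2_tclass[OF assms(1)] F.add eq ..
  moreover have "sum\<^sub>\<Delta> (c *s a) f = c *s sum\<^sub>\<Delta> a f" for c a
    unfolding comult_scale tscale_def tsum2_tclass[OF assms(1)] F.scale eq ..
  ultimately show ?thesis using assms(2) by (simp add: lin_def)
qed

lemma Phi_closed: "\<Phi> \<in> tensor_power 3"
  using Phi_invertible by (simp add: tinvertible_def)

lemma Psi_closed: "tinv 3 \<Phi> \<in> tensor_power 3"
  and Phi_Psi: "tmult 3 \<Phi> (tinv 3 \<Phi>) = tone 3"
  and Psi_Phi: "tmult 3 (tinv 3 \<Phi>) \<Phi> = tone 3"
  using is_tinverse_tinv[OF Phi_invertible] by (auto simp: is_tinverse_def)

lemma sum_Phi_Psi:
  "trilin f \<Longrightarrow>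
    sum\<^sub>\<Phi> (\<lambda>a b c. sum\<^sub>\<Psi> (\<lambda>x y z. f (a * x) (b * y) (c * z))) = f 1 1 1"
  using tsum3_tmult[OF Phi_closed Psi_closed, of f] by (simp add: Phi_Psi tsum3_tone)

lemma sum_comult_one: "bilin f \<Longrightarrow> sum\<^sub>\<Delta> 1 f = f 1 1"
  by (simp add: comult_one tsum2_tone)

lemma sum_counit_left: "lin f \<Longrightarrow> sum\<^sub>\<Delta> a (\<lambda>x y. \<epsilon> x *s f y) = f a"
  using lin_tsum2[of f "\<Delta> a" "\<lambda>x y. \<epsilon> x *s y"] by (simp add: counit_left lin_scale)

lemma sum_counit_right: "lin f \<Longrightarrow> sum\<^sub>\<Delta> a (\<lambda>x y. \<epsilon> y *s f x) = f a"
  using lin_tsum2[of f "\<Delta> a" "\<lambda>x y. \<epsilon> y *s x"] by (simp add: counit_right lin_scale)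

lemma sum_counit_Phi_mid: "bilin f \<Longrightarrow> sum\<^sub>\<Phi> (\<lambda>x y z. \<epsilon> y *s f x z) = f 1 1"
  using tsum2_counit_at[OF Phi_closed, of f \<epsilon>] by (simp only: counit_Phi tsum2_tone)

text \<open>Quasi-coassociativity multiplied by the inverse of \<Phi> on both sides. The inverse is
  wanted because the Drinfel'd element is a sum over it.\<close>

lemma Psi_quasi_coassoc:
  "tmult 3 (tinv 3 \<Phi>) (comult_at \<Delta> 2 1 (\<Delta> a)) = tmult 3 (comult_at \<Delta> 2 0 (\<Delta> a)) (tinv 3 \<Phi>)"
proof -
  let ?C = "\<lambda>i. comult_at \<Delta> 2 i (\<Delta> a)" and ?\<Psi> = "tinv 3 \<Phi>"
  have C: "?C i \<in> tensor_power 3" if "i < 2" for i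
    using comult_at_closed[OF comult_closed that, of \<Delta> a] comult_closed by simp
  note cl = C Phi_closed Psi_closed tmult_closed tone_closed
  have "tmult 3 ?\<Psi> (?C 1) = tmult 3 (tmult 3 ?\<Psi> (?C 1)) (tmult 3 \<Phi> ?\<Psi>)"
    by (simp add: Phi_Psi tmult_tone cl)
  also have "\<dots> = tmult 3 ?\<Psi> (tmult 3 (tmult 3 (?C 1) \<Phi>) ?\<Psi>)"
    by (simp add: tmult_assoc cl)
  also have "\<dots> = tmult 3 (tmult 3 ?\<Psi> \<Phi>) (tmult 3 (?C 0) ?\<Psi>)"
    by (simp only: quasi_coassoc) (simp add: tmult_assoc cl)
  also have "\<dots> = tmult 3 (?C 0) ?\<Psi>"
    by (simp add: Psi_Phi tmult_tone cl)
  finally show ?thesis .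
qed

lemma sum_quasi_coassoc:
  assumes f: "trilin f"
  shows "sum\<^sub>\<Psi> (\<lambda>p q r. sum\<^sub>\<Delta> a (\<lambda>x y. sum\<^sub>\<Delta> y (\<lambda>y\<^sub>1 y\<^sub>2. f (p * x) (q * y\<^sub>1) (r * y\<^sub>2)))) =
    sum\<^sub>\<Delta> a (\<lambda>x y. sum\<^sub>\<Delta> x (\<lambda>x\<^sub>1 x\<^sub>2. sum\<^sub>\<Psi> (\<lambda>p q r. f (x\<^sub>1 * p) (x\<^sub>2 * q) (y * r))))"
proof -
  have C: "comult_at \<Delta> 2 i (\<Delta> a) \<in> tensor_power 3" if "i < 2" for i
    using comult_at_closed[OF comult_closed that, of \<Delta> a] comult_closed by simp
  have "tsum3 scale (tmult 3 (tinv 3 \<Phi>) (comult_at \<Delta> 2 1 (\<Delta> a))) f =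
      tsum3 scale (tmult 3 (comult_at \<Delta> 2 0 (\<Delta> a)) (tinv 3 \<Phi>)) f"
    by (simp only: Psi_quasi_coassoc)
  also have "tsum3 scale (tmult 3 (tinv 3 \<Phi>) (comult_at \<Delta> 2 1 (\<Delta> a))) f =
      sum\<^sub>\<Psi> (\<lambda>p q r. sum\<^sub>\<Delta> a (\<lambda>x y. sum\<^sub>\<Delta> y (\<lambda>y\<^sub>1 y\<^sub>2. f (p * x) (q * y\<^sub>1) (r * y\<^sub>2))))"
    by (subst tsum3_tmult[OF Psi_closed C f], simp, subst tsum3_comult_at(2))
      (intro comult_closed lin_intros trilin_lin[OF f] refl)+
  also have "tsum3 scale (tmult 3 (comult_at \<Delta> 2 0 (\<Delta> a)) (tinv 3 \<Phi>)) f =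
      sum\<^sub>\<Delta> a (\<lambda>x y. sum\<^sub>\<Delta> x (\<lambda>x\<^sub>1 x\<^sub>2. sum\<^sub>\<Psi> (\<lambda>p q r. f (x\<^sub>1 * p) (x\<^sub>2 * q) (y * r))))"
    by (subst tsum3_tmult[OF C Psi_closed f], simp, subst tsum3_comult_at(1))
      (intro comult_closed lin_intros trilin_lin[OF f] refl)+
  finally show ?thesis .
qed

text \<open>Letters by origin. On the left, unprimed: (id \<otimes> id \<otimes> \<Delta>)(\<Phi>),
  primed: (\<Delta> \<otimes> id \<otimes> id)(\<Phi>). On the right, lower case: 1 \<otimes>
  \<Phi>, unprimed upper case: (id \<otimes> \<Delta> \<otimes> id)(\<Phi>), primed: \<Phi>
  \<otimes> 1.\<close>

lemma sum_pentagon: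
  assumes f: "quadlin f"
  shows "sum\<^sub>\<Phi> (\<lambda>X Y Z. sum\<^sub>\<Delta> Z (\<lambda>Z\<^sub>1 Z\<^sub>2. sum\<^sub>\<Phi> (\<lambda>X' Y' Z'. sum\<^sub>\<Delta> X' (\<lambda>X\<^sub>1 X\<^sub>2.
      f (X * X\<^sub>1) (Y * X\<^sub>2) (Z\<^sub>1 * Y') (Z\<^sub>2 * Z'))))) =
    sum\<^sub>\<Phi> (\<lambda>x y z. sum\<^sub>\<Phi> (\<lambda>X Y Z. sum\<^sub>\<Delta> Y (\<lambda>Y\<^sub>1 Y\<^sub>2. sum\<^sub>\<Phi> (\<lambda>X' Y' Z'.
      f (X * X') (x * Y\<^sub>1 * Y') (y * Y\<^sub>2 * Z') (z * Z)))))"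
proof -
  have C: "comult_at \<Delta> 3 i \<Phi> \<in> tensor_power 4" if "i < 3" for i
    using comult_at_closed[OF Phi_closed that, of \<Delta>] comult_closed by simp
  have O: "one_tensor 3 \<Phi> \<in> tensor_power 4" "tensor_one 3 \<Phi> \<in> tensor_power 4"
    using one_tensor_closed[OF Phi_closed] tensor_one_closed[OF Phi_closed] by simp_all
  have "tsum4 scale (tmult 4 (comult_at \<Delta> 3 2 \<Phi>) (comult_at \<Delta> 3 0 \<Phi>)) f =
      tsum4 scale (tmult 4 (tmult 4 (one_tensor 3 \<Phi>) (comult_at \<Delta> 3 1 \<Phi>)) (tensor_one 3 \<Phi>)) f"
    by (simp only: pentagon)
  also have "tsum4 scale (tmult 4 (comult_at \<Delta> 3 2 \<Phi>) (comult_at \<Delta> 3 0 \<Phi>)) f =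
    tsum4 scale (comult_at \<Delta> 3 2 \<Phi>) (\<lambda>a b c d.
      sum\<^sub>\<Phi> (\<lambda>X' Y' Z'. sum\<^sub>\<Delta> X' (\<lambda>X\<^sub>1 X\<^sub>2. f (a * X\<^sub>1) (b * X\<^sub>2) (c * Y') (d * Z'))))"
    by (subst tsum4_tmult[OF C C f], simp, simp, subst tsum4_comult_at(1))
      (intro comult_closed Phi_closed lin_intros quadlin_lin[OF f] refl)+
  also have "\<dots> = sum\<^sub>\<Phi> (\<lambda>X Y Z. sum\<^sub>\<Delta> Z (\<lambda>Z\<^sub>1 Z\<^sub>2. sum\<^sub>\<Phi> (\<lambda>X' Y' Z'. sum\<^sub>\<Delta> X' (\<lambda>X\<^sub>1 X\<^sub>2.
      f (X * X\<^sub>1) (Y * X\<^sub>2) (Z\<^sub>1 * Y') (Z\<^sub>2 * Z')))))"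
    by (subst tsum4_comult_at(3))
      (intro comult_closed Phi_closed lin_intros quadlin_lin[OF f] refl)+
  also have "tsum4 scale (tmult 4 (tmult 4 (one_tensor 3 \<Phi>) (comult_at \<Delta> 3 1 \<Phi>))
      (tensor_one 3 \<Phi>)) f =
    tsum4 scale (tmult 4 (one_tensor 3 \<Phi>) (comult_at \<Delta> 3 1 \<Phi>)) (\<lambda>a b c d.
      sum\<^sub>\<Phi> (\<lambda>X' Y' Z'. f (a * X') (b * Y') (c * Z') (d * 1)))"
    by (subst tsum4_tmult[OF tmult_closed[OF O(1) C] O(2) f], simp, subst tsum4_tensor_one)
      (intro comult_closed Phi_closed lin_intros quadlin_lin[OF f] refl)+
  also have "\<dots> = tsum4 scale (one_tensor 3 \<Phi>) (\<lambda>x' x y z.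
      sum\<^sub>\<Phi> (\<lambda>X Y Z. sum\<^sub>\<Delta> Y (\<lambda>Y\<^sub>1 Y\<^sub>2. sum\<^sub>\<Phi> (\<lambda>X' Y' Z'.
        f (x' * X * X') (x * Y\<^sub>1 * Y') (y * Y\<^sub>2 * Z') (z * Z * 1)))))"
    by (subst tsum4_tmult[OF O(1) C], simp,
        (intro comult_closed Phi_closed lin_intros quadlin_lin[OF f] refl)+,
        subst tsum4_comult_at(2))
      (intro comult_closed Phi_closed lin_intros quadlin_lin[OF f] refl)+
  also have "\<dots> = sum\<^sub>\<Phi> (\<lambda>x y z. sum\<^sub>\<Phi> (\<lambda>X Y Z. sum\<^sub>\<Delta> Y (\<lambda>Y\<^sub>1 Y\<^sub>2. sum\<^sub>\<Phi> (\<lambda>X' Y' Z'.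
        f (1 * X * X') (x * Y\<^sub>1 * Y') (y * Y\<^sub>2 * Z') (z * Z * 1)))))"
    by (subst tsum4_one_tensor)
      (intro comult_closed Phi_closed lin_intros quadlin_lin[OF f] refl)+
  \<comment> \<open>The units of 1 \<otimes> \<Phi> and \<Phi> \<otimes> 1 are still present as
    factors 1 in the first and last argument.\<close>
  finally show ?thesis by simp
qed

text \<open>The pentagon identity multiplied from the right by \<open>\<Phi>\<inverse> \<otimes> 1\<close>.\<close>

lemma sum_pentagon_Psi:
  assumes f: "quadlin f"
  shows "sum\<^sub>\<Phi> (\<lambda>X Y Z. sum\<^sub>\<Delta> Z (\<lambda>Z\<^sub>1 Z\<^sub>2. sum\<^sub>\<Phi> (\<lambda>X' Y' Z'. sum\<^sub>\<Delta> X' (\<lambda>X\<^sub>1 X\<^sub>2.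
      sum\<^sub>\<Psi> (\<lambda>p q r. f (X * X\<^sub>1 * p) (Y * X\<^sub>2 * q) (Z\<^sub>1 * Y' * r) (Z\<^sub>2 * Z')))))) =
    sum\<^sub>\<Phi> (\<lambda>x y z. sum\<^sub>\<Phi> (\<lambda>X Y Z. sum\<^sub>\<Delta> Y (\<lambda>Y\<^sub>1 Y\<^sub>2. f X (x * Y\<^sub>1) (y * Y\<^sub>2) (z * Z))))"
proof -
  have "sum\<^sub>\<Phi> (\<lambda>X' Y' Z'. sum\<^sub>\<Psi> (\<lambda>p q r. f (X * X' * p) (x * Y' * q) (y * Z' * r) w))
      = f X x y w" for X x y w
    using sum_Phi_Psi[of "\<lambda>a b c. f (X * a) (x * b) (y * c) w"]
    by (simp add: mult.assoc lin_intros quadlin_lin[OF f])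
  \<comment> \<open>The test map has right multiplication by the inverse of \<Phi> built in; on the
    right-hand side this meets \<Phi> \<otimes> 1 and cancels by the preceding equation.\<close>
  moreover have "quadlin (\<lambda>a b c d. sum\<^sub>\<Psi> (\<lambda>p q r. f (a * p) (b * q) (c * r) d))"
    by (intro lin_intros quadlin_lin[OF f])
  note sum_pentagon[OF this]
  ultimately show ?thesis by simp
qed

section \<open>Counits on the outer factors of \<Phi>\<close>

lemma sum_counit_comult: "sum\<^sub>\<Delta> a (\<lambda>x y. \<epsilon> (b * x) *s \<epsilon> (c * y) *s t) = \<epsilon> b *s \<epsilon> c *s \<epsilon> a *s t"
proof -
  have "sum\<^sub>\<Delta> a (\<lambda>x y. \<epsilon> x *s \<epsilon> b *s \<epsilon> c *s \<epsilon> y *s t) = \<epsilon> b *s \<epsilon> c *s \<epsilon> a *s t"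
    by (rule sum_counit_left) (intro lin_intros)
  then show ?thesis by (simp add: counit_mult_scale mult_ac counit_mult)
qed

text \<open>Apply \<epsilon> \<otimes> \<epsilon> \<otimes> id \<otimes> id to the pentagon. With P
  = (\<epsilon> \<otimes> id \<otimes> id)(\<Phi>) its left side becomes P and its right side P P,
  the other factors being 1 by the middle counit axiom. As P is invertible, P = 1.\<close>

lemma sum_counit_Phi_left:
  assumes g: "bilin g"
  shows "sum\<^sub>\<Phi> (\<lambda>x y z. \<epsilon> x *s g y z) = g 1 1"
proof -
  \<comment> \<open>g after right multiplication by the inverse of P, which is \<epsilon> applied to
    the first factor of the inverse of \<Phi>. Tested on h, the equation P = P P reads 1 =
    P.\<close>
  define h where "h c d = sum\<^sub>\<Psi> (\<lambda>p q r. \<epsilon> p *s g (c * q) (d * r))" for c d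
  have h: "bilin h" unfolding h_def by (intro lin_intros bilin_lin[OF g])
  note lin = lin_intros bilin_lin[OF g] bilin_lin[OF h]
  have cancel: "sum\<^sub>\<Phi> (\<lambda>x y z. \<epsilon> x *s h (c * y) (d * z)) = g c d" for c d
  proof -
    have "sum\<^sub>\<Phi> (\<lambda>a b e. sum\<^sub>\<Psi> (\<lambda>p q r. \<epsilon> (a * p) *s g (c * (b * q)) (d * (e * r))))
        = \<epsilon> 1 *s g (c * 1) (d * 1)"
      by (rule sum_Phi_Psi) (intro lin)
    then show ?thesis
      by (simp only: h_def tsum3_scale counit_mult_scale mult.assoc counit_one scale_one mult_1_right)
  qed
  have f: "quadlin (\<lambda>a b c d. \<epsilon> a *s \<epsilon> b *s h c d)" by (intro lin)
  \<comment> \<open>The inner \<Phi> contributes P, which h cancels; the outer one vanishes under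
    \<epsilon> on its middle factor.\<close>
  have "sum\<^sub>\<Phi> (\<lambda>X Y Z. sum\<^sub>\<Delta> Z (\<lambda>Z\<^sub>1 Z\<^sub>2. sum\<^sub>\<Phi> (\<lambda>X' Y' Z'. sum\<^sub>\<Delta> X' (\<lambda>X\<^sub>1 X\<^sub>2.
      \<epsilon> (X * X\<^sub>1) *s \<epsilon> (Y * X\<^sub>2) *s h (Z\<^sub>1 * Y') (Z\<^sub>2 * Z')))))
    = sum\<^sub>\<Phi> (\<lambda>X Y Z. \<epsilon> Y *s \<epsilon> X *s sum\<^sub>\<Delta> Z g)"
    by (simp only: sum_counit_comult tsum3_scale tsum2_scale cancel scale_left_commute)
  also have "\<dots> = \<epsilon> 1 *s sum\<^sub>\<Delta> 1 g"
    by (rule sum_counit_Phi_mid) (intro lin g)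
  also have "\<dots> = g 1 1"
    by (simp add: counit_one sum_comult_one g)
  finally have lhs: "g 1 1 = sum\<^sub>\<Phi> (\<lambda>x y z. sum\<^sub>\<Phi> (\<lambda>X Y Z. sum\<^sub>\<Delta> Y (\<lambda>Y\<^sub>1 Y\<^sub>2. sum\<^sub>\<Phi> (\<lambda>X' Y' Z'.
      \<epsilon> (X * X') *s \<epsilon> (x * Y\<^sub>1 * Y') *s h (y * Y\<^sub>2 * Z') (z * Z)))))"
    using sum_pentagon[OF f] by simp
  \<comment> \<open>The factor \<Phi> \<otimes> 1 drops out, since (\<epsilon> \<otimes> \<epsilon>
    \<otimes> id)(\<Phi>) = 1.\<close>
  have "sum\<^sub>\<Phi> (\<lambda>X' Y' Z'. \<epsilon> (X * X') *s \<epsilon> (b * Y') *s h (c * Z') d) = \<epsilon> X *s \<epsilon> b *s h c d"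
    for X b c d
  proof -
    have "sum\<^sub>\<Phi> (\<lambda>X' Y' Z'. \<epsilon> Y' *s \<epsilon> X *s \<epsilon> X' *s \<epsilon> b *s h (c * Z') d)
        = \<epsilon> X *s \<epsilon> 1 *s \<epsilon> b *s h (c * 1) d"
      by (rule sum_counit_Phi_mid) (intro lin)
    then show ?thesis by (simp add: counit_mult counit_one mult_ac)
  qed
  moreover have "sum\<^sub>\<Delta> Y (\<lambda>Y\<^sub>1 Y\<^sub>2. \<epsilon> X *s \<epsilon> (x * Y\<^sub>1) *s h (y * Y\<^sub>2) d)
      = \<epsilon> x *s \<epsilon> X *s h (y * Y) d" for X x Y y d
  proof -
    have "sum\<^sub>\<Delta> Y (\<lambda>Y\<^sub>1 Y\<^sub>2. \<epsilon> Y\<^sub>1 *s \<epsilon> x *s \<epsilon> X *s h (y * Y\<^sub>2) d) = \<epsilon> x *s \<epsilon> X *s h (y * Y) d"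
      by (rule sum_counit_left) (intro lin)
    then show ?thesis by (simp add: counit_mult mult_ac)
  qed
  ultimately show ?thesis
    unfolding lhs by (simp only: tsum3_scale cancel)
qed

text \<open>The mirror argument: under id \<otimes> id \<otimes> \<epsilon> \<otimes> \<epsilon> the
  pentagon says Q = Q Q for Q = (id \<otimes> id \<otimes> \<epsilon>)(\<Phi>), and h divides by Q
  on the right.\<close>

lemma sum_counit_Phi_right:
  assumes g: "bilin g"
  shows "sum\<^sub>\<Phi> (\<lambda>x y z. \<epsilon> z *s g x y) = g 1 1"
proof -
  define h where "h a b = sum\<^sub>\<Psi> (\<lambda>p q r. \<epsilon> r *s g (a * p) (b * q))" for a b
  have h: "bilin h" unfolding h_def by (intro lin_intros bilin_lin[OF g])
  note lin = lin_intros bilin_lin[OF g] bilin_lin[OF h]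
  have cancel: "sum\<^sub>\<Phi> (\<lambda>x y z. \<epsilon> z *s h (a * x) (b * y)) = g a b" for a b
  proof -
    have "sum\<^sub>\<Phi> (\<lambda>x y z. sum\<^sub>\<Psi> (\<lambda>p q r. \<epsilon> (z * r) *s g (a * (x * p)) (b * (y * q))))
        = \<epsilon> 1 *s g (a * 1) (b * 1)"
      by (rule sum_Phi_Psi) (intro lin)
    then show ?thesis
      by (simp only: h_def tsum3_scale counit_mult_scale mult.assoc counit_one scale_one mult_1_right)
  qed
  have f: "quadlin (\<lambda>a b c d. \<epsilon> c *s \<epsilon> d *s h a b)" by (intro lin)
  have "sum\<^sub>\<Phi> (\<lambda>X' Y' Z'. sum\<^sub>\<Delta> X' (\<lambda>X\<^sub>1 X\<^sub>2. \<epsilon> (c * Y') *s \<epsilon> (d * Z') *s h (X * X\<^sub>1) (Y * X\<^sub>2)))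
      = \<epsilon> c *s \<epsilon> d *s h X Y" for c d X Y
  proof -
    have "sum\<^sub>\<Phi> (\<lambda>X' Y' Z'. \<epsilon> Y' *s \<epsilon> c *s \<epsilon> d *s \<epsilon> Z' *s
        sum\<^sub>\<Delta> X' (\<lambda>X\<^sub>1 X\<^sub>2. h (X * X\<^sub>1) (Y * X\<^sub>2)))
        = \<epsilon> c *s \<epsilon> d *s \<epsilon> 1 *s sum\<^sub>\<Delta> 1 (\<lambda>X\<^sub>1 X\<^sub>2. h (X * X\<^sub>1) (Y * X\<^sub>2))"
      by (rule sum_counit_Phi_mid) (intro lin)
    also have "sum\<^sub>\<Delta> 1 (\<lambda>X\<^sub>1 X\<^sub>2. h (X * X\<^sub>1) (Y * X\<^sub>2)) = h (X * 1) (Y * 1)"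
      by (rule sum_comult_one) (intro lin)
    finally show ?thesis by (simp add: tsum2_scale counit_mult counit_one mult_ac)
  qed
  moreover have "sum\<^sub>\<Delta> Z (\<lambda>Z\<^sub>1 Z\<^sub>2. \<epsilon> Z\<^sub>1 *s \<epsilon> Z\<^sub>2 *s t) = \<epsilon> Z *s t" for Z t
    by (rule sum_counit_left) (intro lin)
  ultimately have "sum\<^sub>\<Phi> (\<lambda>X Y Z. sum\<^sub>\<Delta> Z (\<lambda>Z\<^sub>1 Z\<^sub>2. sum\<^sub>\<Phi> (\<lambda>X' Y' Z'. sum\<^sub>\<Delta> X' (\<lambda>X\<^sub>1 X\<^sub>2.
      \<epsilon> (Z\<^sub>1 * Y') *s \<epsilon> (Z\<^sub>2 * Z') *s h (X * X\<^sub>1) (Y * X\<^sub>2)))))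
    = sum\<^sub>\<Phi> (\<lambda>X Y Z. \<epsilon> Z *s h (1 * X) (1 * Y))"
    by (simp only: mult_1_left)
  also have "\<dots> = g 1 1" by (rule cancel)
  finally have lhs: "g 1 1 = sum\<^sub>\<Phi> (\<lambda>x y z. sum\<^sub>\<Phi> (\<lambda>X Y Z. sum\<^sub>\<Delta> Y (\<lambda>Y\<^sub>1 Y\<^sub>2. sum\<^sub>\<Phi> (\<lambda>X' Y' Z'.
      \<epsilon> (y * Y\<^sub>2 * Z') *s \<epsilon> (z * Z) *s h (X * X') (x * Y\<^sub>1 * Y')))))"
    using sum_pentagon[OF f] by simp
  \<comment> \<open>Here \<Phi> \<otimes> 1 is the factor cancelled by h, while 1 \<otimes> \<Phi>
    disappears at the end by the middle counit axiom.\<close>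
  have "sum\<^sub>\<Phi> (\<lambda>X' Y' Z'. \<epsilon> (y * Z') *s \<epsilon> d *s h (X * X') (x * Y')) = \<epsilon> y *s \<epsilon> d *s g X x"
    for X x y d
  proof -
    have "sum\<^sub>\<Phi> (\<lambda>X' Y' Z'. \<epsilon> (y * Z') *s \<epsilon> d *s h (X * X') (x * Y'))
        = sum\<^sub>\<Phi> (\<lambda>X' Y' Z'. \<epsilon> y *s \<epsilon> d *s \<epsilon> Z' *s h (X * X') (x * Y'))"
      by (simp add: counit_mult mult_ac)
    then show ?thesis by (simp only: tsum3_scale cancel)
  qed
  moreover have "sum\<^sub>\<Delta> Y (\<lambda>Y\<^sub>1 Y\<^sub>2. \<epsilon> (y * Y\<^sub>2) *s \<epsilon> (z * Z) *s g X (x * Y\<^sub>1))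
      = \<epsilon> y *s \<epsilon> z *s \<epsilon> Z *s g X (x * Y)" for X x Y y z Z
  proof -
    have "sum\<^sub>\<Delta> Y (\<lambda>Y\<^sub>1 Y\<^sub>2. \<epsilon> Y\<^sub>2 *s \<epsilon> y *s \<epsilon> z *s \<epsilon> Z *s g X (x * Y\<^sub>1))
        = \<epsilon> y *s \<epsilon> z *s \<epsilon> Z *s g X (x * Y)"
      by (rule sum_counit_right) (intro lin)
    then show ?thesis by (simp add: counit_mult mult_ac)
  qed
  ultimately have "g 1 1 = sum\<^sub>\<Phi> (\<lambda>x y z. \<epsilon> y *s \<epsilon> z *s sum\<^sub>\<Phi> (\<lambda>X Y Z. \<epsilon> Z *s g X (x * Y)))"
    unfolding lhs by (simp only: tsum3_scale)
  also have "\<dots> = \<epsilon> 1 *s sum\<^sub>\<Phi> (\<lambda>X Y Z. \<epsilon> Z *s g X (1 * Y))"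
    by (rule sum_counit_Phi_mid) (intro lin)
  finally show ?thesis by (simp add: counit_one)
qed

end

section \<open>Uniqueness of the antipode\<close>

context quasi_hopf_algebra
begin

lemma lin_antipode [lin_intros]: "lin f \<Longrightarrow> lin (\<lambda>x. S (f x))"
proof -
  interpret S: Vector_Spaces.linear scale scale S by (rule antipode_linear)
  show "lin f \<Longrightarrow> lin (\<lambda>x. S (f x))" by (simp add: lin_def S.add S.scale)
qed

lemma sum_antipode_alpha: "lin f \<Longrightarrow> sum\<^sub>\<Delta> a (\<lambda>x y. f (S x * \<alpha> * y)) = \<epsilon> a *s f \<alpha>"
  using lin_tsum2[of f "\<Delta> a" "\<lambda>x y. S x * \<alpha> * y"] by (simp add: antipode_alpha lin_scale)

lemma sum_antipode_beta: "lin f \<Longrightarrow> sum\<^sub>\<Delta> a (\<lambda>x y. f (x * \<beta> * S y)) = \<epsilon> a *s f \<beta>"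
  using lin_tsum2[of f "\<Delta> a" "\<lambda>x y. x * \<beta> * S y"] by (simp add: antipode_beta lin_scale)

text \<open>For \<open>\<gamma> = \<Sum> S(t) \<alpha> s\<close> this is the Drinfel'd element.\<close>

definition intertwiner :: "'a \<Rightarrow> 'a"
  where "intertwiner \<gamma> = sum\<^sub>\<Psi> (\<lambda>X Y Z. S (Y * \<beta> * S Z) * \<gamma> * X)"

text \<open>
  The hypothesis says that \<open>\<gamma>\<close> plays the role of \<open>\<alpha>\<close> for the antihomomorphism S and the
  opposite comultiplication, which has the antipode \<open>S\<inverse>\<close>: this is
  the situation of the uniqueness of the antipode up to conjugation.
\<close>

context
  fixes \<gamma>
  assumes \<gamma>: "\<And>a. sum\<^sub>\<Delta> a (\<lambda>x y. S y * \<gamma> * x) = \<epsilon> a *s \<gamma>"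
begin

lemma sum_antipode_gamma: "lin f \<Longrightarrow> sum\<^sub>\<Delta> a (\<lambda>x y. f (S y * \<gamma> * x)) = \<epsilon> a *s f \<gamma>"
  using lin_tsum2[of f "\<Delta> a" "\<lambda>x y. S y * \<gamma> * x"] by (simp add: \<gamma> lin_scale)

text \<open>Quasi-coassociativity is tested on \<open>?h\<close>. As S reverses products, on one
  side the legs in the last two factors enclose \<beta> and collapse, leaving a on the right; on the
  other side the legs in the first two factors enclose \<gamma> and collapse, leaving a in the third
  factor, from where it emerges on the left under S twice.\<close>

lemma intertwiner_commute: "intertwiner \<gamma> * a = S (S a) * intertwiner \<gamma>"
proof -
  let ?h = "\<lambda>x y z. S (y * \<beta> * S z) * \<gamma> * x"
  have "sum\<^sub>\<Delta> b (\<lambda>y\<^sub>1 y\<^sub>2. ?h x (q * y\<^sub>1) (r * y\<^sub>2)) = \<epsilon> b *s ?h x q r" for b x q r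
  proof -
    have "sum\<^sub>\<Delta> b (\<lambda>y\<^sub>1 y\<^sub>2. S (q * (y\<^sub>1 * \<beta> * S y\<^sub>2) * S r) * \<gamma> * x) = \<epsilon> b *s (S (q * \<beta> * S r) * \<gamma> * x)"
      by (rule sum_antipode_beta) (intro lin_intros)
    then show ?thesis by (simp add: antipode_mult mult.assoc)
  qed
  moreover have "sum\<^sub>\<Delta> a (\<lambda>x y. \<epsilon> y *s ?h (p * x) q r) = ?h (p * a) q r" for p q r
    by (rule sum_counit_right) (intro lin_intros)
  ultimately have lhs:
    "sum\<^sub>\<Psi> (\<lambda>p q r. sum\<^sub>\<Delta> a (\<lambda>x y. sum\<^sub>\<Delta> y (\<lambda>y\<^sub>1 y\<^sub>2. ?h (p * x) (q * y\<^sub>1) (r * y\<^sub>2))))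
      = intertwiner \<gamma> * a"
    by (simp only: intertwiner_def tsum3_mult_left mult.assoc)
  have "sum\<^sub>\<Delta> b (\<lambda>x\<^sub>1 x\<^sub>2. sum\<^sub>\<Psi> (\<lambda>p q r. ?h (x\<^sub>1 * p) (x\<^sub>2 * q) (y * r)))
      = \<epsilon> b *s sum\<^sub>\<Psi> (\<lambda>p q r. ?h p q (y * r))" for b y
  proof -
    have "sum\<^sub>\<Delta> b (\<lambda>x\<^sub>1 x\<^sub>2. sum\<^sub>\<Psi> (\<lambda>p q r. S (q * \<beta> * S (y * r)) * (S x\<^sub>2 * \<gamma> * x\<^sub>1) * p))
        = \<epsilon> b *s sum\<^sub>\<Psi> (\<lambda>p q r. S (q * \<beta> * S (y * r)) * \<gamma> * p)"
      by (rule sum_antipode_gamma) (intro lin_intros)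
    then show ?thesis by (simp add: antipode_mult mult.assoc)
  qed
  then have "sum\<^sub>\<Delta> a (\<lambda>x y. sum\<^sub>\<Delta> x (\<lambda>x\<^sub>1 x\<^sub>2. sum\<^sub>\<Psi> (\<lambda>p q r. ?h (x\<^sub>1 * p) (x\<^sub>2 * q) (y * r))))
      = sum\<^sub>\<Delta> a (\<lambda>x y. \<epsilon> x *s sum\<^sub>\<Psi> (\<lambda>p q r. ?h p q (y * r)))"
    by (simp only:)
  also have "\<dots> = sum\<^sub>\<Psi> (\<lambda>p q r. ?h p q (a * r))"
    by (rule sum_counit_left) (intro lin_intros)
  also have "\<dots> = S (S a) * intertwiner \<gamma>"
    by (simp add: intertwiner_def tsum3_mult_right antipode_mult mult.assoc)
  finally have rhs: "sum\<^sub>\<Delta> a (\<lambda>x y. sum\<^sub>\<Delta> x (\<lambda>x\<^sub>1 x\<^sub>2. sum\<^sub>\<Psi> (\<lambda>p q r.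
      ?h (x\<^sub>1 * p) (x\<^sub>2 * q) (y * r)))) = S (S a) * intertwiner \<gamma>" .
  have "trilin ?h" by (intro lin_intros)
  from sum_quasi_coassoc[OF this, of a] show ?thesis
    by (simp only: lhs rhs)
qed

text \<open>The pentagon with one \<Phi> moved across is tested on \<open>?f\<close>. On its right
  side \<beta> absorbs the legs, the middle counit removes one \<Phi>, and the antipode axiom for
  the other leaves \<gamma>. On its left side \<alpha> and \<gamma> absorb the legs, the outer
  counits remove both \<Phi>, and only the sum over the inverse of \<Phi> remains.\<close>

lemma antipode_alpha_intertwiner: "S \<alpha> * intertwiner \<gamma> = \<gamma>"
proof -
  let ?f = "\<lambda>a b c d. S (b * \<beta> * S c * \<alpha> * d) * \<gamma> * a"
  have f: "quadlin ?f" by (intro lin_intros)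
  have "sum\<^sub>\<Delta> Y (\<lambda>Y\<^sub>1 Y\<^sub>2. ?f X (x * Y\<^sub>1) (y * Y\<^sub>2) (z * Z)) = \<epsilon> Y *s ?f X x y (z * Z)" for x y z X Y Z
  proof -
    have "sum\<^sub>\<Delta> Y (\<lambda>Y\<^sub>1 Y\<^sub>2. S (x * (Y\<^sub>1 * \<beta> * S Y\<^sub>2) * S y * \<alpha> * (z * Z)) * \<gamma> * X)
        = \<epsilon> Y *s (S (x * \<beta> * S y * \<alpha> * (z * Z)) * \<gamma> * X)"
      by (rule sum_antipode_beta) (intro lin_intros)
    then show ?thesis by (simp add: antipode_mult mult.assoc)
  qed
  moreover have "sum\<^sub>\<Phi> (\<lambda>X Y Z. \<epsilon> Y *s ?f X x y (z * Z)) = ?f 1 x y (z * 1)" for x y z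
    by (rule sum_counit_Phi_mid) (intro lin_intros)
  ultimately have "sum\<^sub>\<Phi> (\<lambda>x y z. sum\<^sub>\<Phi> (\<lambda>X Y Z. sum\<^sub>\<Delta> Y (\<lambda>Y\<^sub>1 Y\<^sub>2. ?f X (x * Y\<^sub>1) (y * Y\<^sub>2) (z * Z))))
      = sum\<^sub>\<Phi> (\<lambda>x y z. S (x * \<beta> * S y * \<alpha> * z) * \<gamma>)"
    by (simp only: mult_1_right)
  also have "\<dots> = S (sum\<^sub>\<Phi> (\<lambda>x y z. x * \<beta> * S y * \<alpha> * z)) * \<gamma>"
    by (simp only: lin_tsum3[OF lin_antipode[OF lin_id]] tsum3_mult_left)
  finally have rhs: "sum\<^sub>\<Phi> (\<lambda>x y z. sum\<^sub>\<Phi> (\<lambda>X Y Z. sum\<^sub>\<Delta> Y (\<lambda>Y\<^sub>1 Y\<^sub>2.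
      ?f X (x * Y\<^sub>1) (y * Y\<^sub>2) (z * Z)))) = \<gamma>"
    by (simp add: antipode_Phi antipode_one)
  \<comment> \<open>What remains of the left side once \<alpha> has absorbed the legs of Z. It
    depends on X and Y only, so \<epsilon> on the third factor removes the outer \<Phi>.\<close>
  let ?G = "\<lambda>X Y. sum\<^sub>\<Phi> (\<lambda>X' Y' Z'. sum\<^sub>\<Delta> X' (\<lambda>X\<^sub>1 X\<^sub>2. sum\<^sub>\<Psi> (\<lambda>p q r.
    ?f (X * X\<^sub>1 * p) (Y * X\<^sub>2 * q) (Y' * r) Z')))"
  have "sum\<^sub>\<Delta> Z (\<lambda>Z\<^sub>1 Z\<^sub>2. sum\<^sub>\<Phi> (\<lambda>X' Y' Z'. sum\<^sub>\<Delta> X' (\<lambda>X\<^sub>1 X\<^sub>2. sum\<^sub>\<Psi> (\<lambda>p q r.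
      ?f (X * X\<^sub>1 * p) (Y * X\<^sub>2 * q) (Z\<^sub>1 * Y' * r) (Z\<^sub>2 * Z'))))) = \<epsilon> Z *s ?G X Y" for X Y Z
  proof -
    have "sum\<^sub>\<Delta> Z (\<lambda>Z\<^sub>1 Z\<^sub>2. sum\<^sub>\<Phi> (\<lambda>X' Y' Z'. sum\<^sub>\<Delta> X' (\<lambda>X\<^sub>1 X\<^sub>2. sum\<^sub>\<Psi> (\<lambda>p q r.
        S (Y * X\<^sub>2 * q * \<beta> * S (Y' * r) * (S Z\<^sub>1 * \<alpha> * Z\<^sub>2) * Z') * \<gamma> * (X * X\<^sub>1 * p)))))
      = \<epsilon> Z *s ?G X Y"
      by (rule sum_antipode_alpha) (intro lin_intros)
    then show ?thesis by (simp add: antipode_mult mult.assoc)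
  qed
  moreover have "sum\<^sub>\<Phi> (\<lambda>X Y Z. \<epsilon> Z *s ?G X Y) = ?G 1 1"
    by (rule sum_counit_Phi_right) (intro lin_intros)
  moreover have "sum\<^sub>\<Delta> X' (\<lambda>X\<^sub>1 X\<^sub>2. sum\<^sub>\<Psi> (\<lambda>p q r. ?f (1 * X\<^sub>1 * p) (1 * X\<^sub>2 * q) (Y' * r) Z'))
      = \<epsilon> X' *s sum\<^sub>\<Psi> (\<lambda>p q r. ?f p q (Y' * r) Z')" for X' Y' Z'
  proof -
    have "sum\<^sub>\<Delta> X' (\<lambda>X\<^sub>1 X\<^sub>2. sum\<^sub>\<Psi> (\<lambda>p q r.
        S (q * \<beta> * S (Y' * r) * \<alpha> * Z') * (S X\<^sub>2 * \<gamma> * X\<^sub>1) * p))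
      = \<epsilon> X' *s sum\<^sub>\<Psi> (\<lambda>p q r. ?f p q (Y' * r) Z')"
      by (rule sum_antipode_gamma) (intro lin_intros)
    then show ?thesis by (simp add: antipode_mult mult.assoc)
  qed
  moreover have "sum\<^sub>\<Phi> (\<lambda>X' Y' Z'. \<epsilon> X' *s sum\<^sub>\<Psi> (\<lambda>p q r. ?f p q (Y' * r) Z'))
      = sum\<^sub>\<Psi> (\<lambda>p q r. ?f p q (1 * r) 1)"
    by (rule sum_counit_Phi_left) (intro lin_intros)
  moreover have "sum\<^sub>\<Psi> (\<lambda>p q r. ?f p q (1 * r) 1) = S \<alpha> * intertwiner \<gamma>"
    by (simp add: intertwiner_def tsum3_mult_right antipode_mult mult.assoc)
  ultimately show ?thesis
    using sum_pentagon_Psi[OF f] rhs by (simp only:)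
qed

end

end

section \<open>The Drinfel'd element and ribbon elements\<close>

context quasitriangular_quasi_hopf_algebra
begin

section \<open>Counits of \<Phi> and R\<close>

abbreviation "sum\<^sub>R \<equiv> tsum2 scale R"

lemma R_closed: "R \<in> tensor_power 2"
  using R_invertible by (simp add: tinvertible_def)

lemma sum_counit_Phi: "sum\<^sub>\<Phi> (\<lambda>X Y Z. \<epsilon> X *s \<epsilon> Y *s \<epsilon> Z *s a) = a"
proof -
  have "sum\<^sub>\<Phi> (\<lambda>X Y Z. \<epsilon> X *s \<epsilon> Y *s \<epsilon> Z *s a) = \<epsilon> 1 *s \<epsilon> 1 *s a"
    by (rule sum_counit_Phi_left) (intro lin_intros)
  then show ?thesis by (simp add: counit_one)
qed

lemma sum_counit_Psi: "sum\<^sub>\<Psi> (\<lambda>X Y Z. \<epsilon> X *s \<epsilon> Y *s \<epsilon> Z *s a) = a"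
proof -
  let ?h = "\<lambda>X Y Z. \<epsilon> X *s \<epsilon> Y *s \<epsilon> Z *s a"
  have "sum\<^sub>\<Phi> (\<lambda>X Y Z. sum\<^sub>\<Psi> (\<lambda>X' Y' Z'. ?h (X * X') (Y * Y') (Z * Z'))) = ?h 1 1 1"
    by (rule sum_Phi_Psi) (intro lin_intros)
  moreover have "?h (X * X') (Y * Y') (Z * Z') =
      \<epsilon> X *s \<epsilon> Y *s \<epsilon> Z *s \<epsilon> X' *s \<epsilon> Y' *s \<epsilon> Z' *s a" for X Y Z X' Y' Z'
    by (simp add: counit_mult mult_ac)
  ultimately show ?thesis
    by (simp only: tsum3_scale sum_counit_Phi counit_one scale_one)
qed

text \<open>Applying \<epsilon> to all three factors of the first hexagon leaves E = E E for E =
  (\<epsilon> \<otimes> \<epsilon>)(R), the associators contributing 1. Invertibility of R passes to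
  E.\<close>

lemma sum_counit_R: "sum\<^sub>R (\<lambda>s t. \<epsilon> s *s \<epsilon> t *s a) = a"
proof -
  \<comment> \<open>Sums take values in A, so the scalar (\<epsilon> \<otimes> \<epsilon>)(R) is
    represented by the corresponding multiple of 1.\<close>
  define E where "E = sum\<^sub>R (\<lambda>s t. \<epsilon> s *s \<epsilon> t *s 1)"
  have E: "sum\<^sub>R (\<lambda>s t. \<epsilon> s *s \<epsilon> t *s b) = E * b" for b
    by (simp only: E_def tsum2_mult_left scale_mult_left mult_1_left)
  let ?f = "\<lambda>a b c. \<epsilon> a *s \<epsilon> b *s \<epsilon> c *s 1"
  have f: "trilin ?f" by (intro lin_intros)
  have "sum\<^sub>\<Delta> s (\<lambda>x y. ?f x y t) = \<epsilon> s *s \<epsilon> t *s 1" for s t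
    by (rule sum_counit_left) (intro lin_intros)
  then have "E = tsum3 scale (comult_at \<Delta> 2 0 R) ?f"
    by (simp only: tsum3_comult_at(1)[OF R_closed comult_closed f] E_def)
  also have "\<dots> =
    sum\<^sub>\<Phi> (\<lambda>X\<^sub>i Y\<^sub>i Z\<^sub>i. sum\<^sub>\<Psi> (\<lambda>X\<^sub>j Y\<^sub>j Z\<^sub>j. sum\<^sub>\<Phi> (\<lambda>X\<^sub>k Y\<^sub>k Z\<^sub>k.
      sum\<^sub>R (\<lambda>s\<^sub>l t\<^sub>l. sum\<^sub>R (\<lambda>s\<^sub>q t\<^sub>q. ?f (Y\<^sub>i * s\<^sub>l * X\<^sub>j * X\<^sub>k)
        (Z\<^sub>i * Z\<^sub>j * s\<^sub>q * Y\<^sub>k) (X\<^sub>i * t\<^sub>l * Y\<^sub>j * t\<^sub>q * Z\<^sub>k))))))"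
    unfolding hexagon_left tsum3_tclass[OF f]
    by (simp add: lin_ext_tsum2 lin_ext_tsum3 lin_ext_word[OF vs_scale])
  also have "\<dots> =
    sum\<^sub>\<Phi> (\<lambda>X\<^sub>i Y\<^sub>i Z\<^sub>i. \<epsilon> X\<^sub>i *s \<epsilon> Y\<^sub>i *s \<epsilon> Z\<^sub>i *s
    sum\<^sub>\<Psi> (\<lambda>X\<^sub>j Y\<^sub>j Z\<^sub>j. \<epsilon> X\<^sub>j *s \<epsilon> Y\<^sub>j *s \<epsilon> Z\<^sub>j *s
    sum\<^sub>\<Phi> (\<lambda>X\<^sub>k Y\<^sub>k Z\<^sub>k. \<epsilon> X\<^sub>k *s \<epsilon> Y\<^sub>k *s \<epsilon> Z\<^sub>k *s
    sum\<^sub>R (\<lambda>s\<^sub>l t\<^sub>l. \<epsilon> s\<^sub>l *s \<epsilon> t\<^sub>l *s sum\<^sub>R (\<lambda>s\<^sub>q t\<^sub>q. \<epsilon> s\<^sub>q *s \<epsilon> t\<^sub>q *s 1)))))"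
    by (simp add: tsum2_scale[symmetric] tsum3_scale[symmetric] counit_mult mult_ac)
  also have "\<dots> = E * E"
    by (simp only: sum_counit_Phi sum_counit_Psi E mult_1_right)
  finally have idem: "E = E * E" .
  \<comment> \<open>The counit value of an inverse of R is a right inverse of E and cancels one
    factor in E = E E.\<close>
  obtain Q where Q: "Q \<in> tensor_power 2" "tmult 2 R Q = tone 2"
    using R_invertible by (auto simp: tinvertible_def is_tinverse_def)
  have g: "bilin (\<lambda>a b. \<epsilon> a *s \<epsilon> b *s 1)" by (intro lin_intros)
  have "sum\<^sub>R (\<lambda>s t. \<epsilon> s *s \<epsilon> t *s tsum2 scale Q (\<lambda>x y. \<epsilon> x *s \<epsilon> y *s 1)) =
      sum\<^sub>R (\<lambda>s t. tsum2 scale Q (\<lambda>x y. \<epsilon> (s * x) *s \<epsilon> (t * y) *s 1))"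
    by (simp add: tsum2_scale[symmetric] counit_mult mult_ac)
  also have "\<dots> = \<epsilon> 1 *s \<epsilon> 1 *s 1"
    unfolding tsum2_tmult[OF R_closed Q(1) g, symmetric] Q(2) by (rule tsum2_tone[OF g])
  finally have "E * tsum2 scale Q (\<lambda>x y. \<epsilon> x *s \<epsilon> y *s 1) = 1"
    by (simp only: E counit_one scale_one)
  then have "E = 1" using idem by (metis mult.assoc mult_1_right)
  then show ?thesis by (simp only: E mult_1_left)
qed

section \<open>R, the element \<gamma> and the Drinfel'd element\<close>

lemma sum_R_comult:
  assumes f: "bilin f"
  shows "sum\<^sub>\<Delta> a (\<lambda>x y. sum\<^sub>R (\<lambda>s t. f (y * s) (x * t))) =
    sum\<^sub>R (\<lambda>s t. sum\<^sub>\<Delta> a (\<lambda>x y. f (s * x) (t * y)))"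
proof -
  have "bilin (\<lambda>x y. sum\<^sub>R (\<lambda>s t. f (x * s) (y * t)))"
    by (intro lin_intros bilin_lin[OF f])
  then have "tsum2 scale (tmult 2 (tflip (\<Delta> a)) R) f =
      sum\<^sub>\<Delta> a (\<lambda>x y. sum\<^sub>R (\<lambda>s t. f (y * s) (x * t)))"
    by (simp add: tsum2_tmult[OF tflip_closed[OF comult_closed] R_closed f] tsum2_tflip)
  then show ?thesis
    by (simp add: R_comult tsum2_tmult[OF R_closed comult_closed f])
qed

definition \<gamma> :: 'a
  where "\<gamma> = sum\<^sub>R (\<lambda>s t. S t * \<alpha> * s)"

lemma lin_gamma: "lin f \<Longrightarrow> sum\<^sub>R (\<lambda>s t. f (S t * \<alpha> * s)) = f \<gamma>"
  by (simp add: \<gamma>_def lin_tsum2)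

text \<open>R exchanges \<Delta> with its opposite, which places the legs of a around \<alpha> in
  the order of the antipode axiom. This is the hypothesis under which
  \<open>intertwiner \<gamma>\<close> was studied.\<close>

lemma sum_gamma: "sum\<^sub>\<Delta> a (\<lambda>x y. S y * \<gamma> * x) = \<epsilon> a *s \<gamma>"
proof -
  let ?f = "\<lambda>x y. S y * \<alpha> * x"
  have "sum\<^sub>\<Delta> a (\<lambda>x y. S y * \<gamma> * x) = sum\<^sub>R (\<lambda>s t. sum\<^sub>\<Delta> a (\<lambda>x y. S y * (S t * \<alpha> * s) * x))"
    by (rule lin_gamma[symmetric]) (intro lin_intros)
  also have "\<dots> = sum\<^sub>R (\<lambda>s t. sum\<^sub>\<Delta> a (\<lambda>x y. ?f (s * x) (t * y)))"
    by (simp add: antipode_mult mult.assoc)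
  also have "\<dots> = sum\<^sub>\<Delta> a (\<lambda>x y. sum\<^sub>R (\<lambda>s t. ?f (y * s) (x * t)))"
    by (rule sum_R_comult[symmetric]) (intro lin_intros)
  also have "\<dots> = sum\<^sub>\<Delta> a (\<lambda>x y. sum\<^sub>R (\<lambda>s t. S t * (S x * \<alpha> * y) * s))"
    by (simp add: antipode_mult mult.assoc)
  also have "\<dots> = \<epsilon> a *s sum\<^sub>R (\<lambda>s t. S t * \<alpha> * s)"
    by (rule sum_antipode_alpha) (intro lin_intros)
  finally show ?thesis by (simp only: \<gamma>_def)
qed

lemma drinfeld_element_eq: "drinfeld_element \<Phi> S \<alpha> \<beta> R = intertwiner \<gamma>"
proof -
  have "sum\<^sub>R (\<lambda>s t. S (Y * \<beta> * S Z) * S t * \<alpha> * s * X) = S (Y * \<beta> * S Z) * \<gamma> * X" for X Y Z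
    by (simp add: \<gamma>_def tsum2_mult_left tsum2_mult_right mult.assoc)
  then show ?thesis by (simp only: drinfeld_element_def intertwiner_def)
qed

text \<open>The pair s, t comes from R', hence t stands in the first argument; the pair s', t' comes
  from R.\<close>

lemma sum_comult_ribbon:
  assumes "\<Delta> v = tmult 2 (tmult 2 (tflip R) R) (tpure [v, v])" and f: "bilin f"
  shows "sum\<^sub>\<Delta> v f = sum\<^sub>R (\<lambda>s t. sum\<^sub>R (\<lambda>s' t'. f (t * s' * v) (s * t' * v)))"
proof -
  have p: "tpure [v, v] \<in> tensor_power 2"
    using tpure_closed[of "[v, v]"] by (simp add: numeral_2_eq_2)
  note R' = tflip_closed[OF R_closed]
  have b: "bilin (\<lambda>a b. f (a * v) (b * v))"
    "bilin (\<lambda>a b. sum\<^sub>R (\<lambda>s' t'. f (a * s' * v) (b * t' * v)))"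
    by (intro lin_intros bilin_lin[OF f])+
  have "tsum2 scale (tpure [v, v]) (\<lambda>c d. f (a * c) (b * d)) = f (a * v) (b * v)" for a b
    by (rule tsum2_tpure) (intro lin_intros bilin_lin[OF f])
  then have "sum\<^sub>\<Delta> v f = tsum2 scale (tmult 2 (tflip R) R) (\<lambda>a b. f (a * v) (b * v))"
    by (simp only: assms(1) tsum2_tmult[OF tmult_closed[OF R' R_closed] p f])
  also have "\<dots> = sum\<^sub>R (\<lambda>s t. sum\<^sub>R (\<lambda>s' t'. f (t * s' * v) (s * t' * v)))"
    by (simp only: tsum2_tmult[OF R' R_closed b(1)] tsum2_tflip[OF b(2)])
  finally show ?thesis .
qed

section \<open>Consequences for a fixed ribbon element\<close>

context
  fixes u v
  assumes ribbon: "ribbon_element \<Delta> S R v"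
  defines "u \<equiv> drinfeld_element \<Phi> S \<alpha> \<beta> R"
begin

lemma ribbon_nonzero: "v \<noteq> 0"
  and ribbon_central: "v * a = a * v"
  and antipode_ribbon: "S v = v"
  and comult_ribbon: "\<Delta> v = tmult 2 (tmult 2 (tflip R) R) (tpure [v, v])"
  using ribbon by (auto simp: ribbon_element_def)

text \<open>As (\<epsilon> \<otimes> \<epsilon>)(R) = 1, applying \<epsilon> \<otimes> \<epsilon> to
  the coproduct of v shows that its counit is an idempotent scalar, so it suffices that it is
  nonzero.\<close>

lemma counit_ribbon: "\<epsilon> v = 1"
proof -
  \<comment> \<open>The counit axiom exhibits v as \<epsilon>(v) times an element of A; a vanishing
    counit would give v = 0.\<close>
  have "\<epsilon> v *s sum\<^sub>R (\<lambda>s t. sum\<^sub>R (\<lambda>s' t'. \<epsilon> (t * s') *s (s * t' * v))) = sum\<^sub>\<Delta> v (\<lambda>x y. \<epsilon> x *s y)"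
    by (subst sum_comult_ribbon[OF comult_ribbon])
      (intro lin_intros, simp add: tsum2_scale[symmetric] counit_mult mult_ac)
  also have "\<dots> = v" by (rule counit_left)
  finally have nz: "\<epsilon> v \<noteq> 0" using ribbon_nonzero by auto
  have "\<epsilon> v *s 1 = sum\<^sub>\<Delta> v (\<lambda>x y. \<epsilon> x *s \<epsilon> y *s 1)"
    by (rule sum_counit_left[symmetric]) (intro lin_intros)
  also have "\<dots> = sum\<^sub>R (\<lambda>s t. sum\<^sub>R (\<lambda>s' t'. \<epsilon> (t * s' * v) *s \<epsilon> (s * t' * v) *s 1))"
    by (rule sum_comult_ribbon[OF comult_ribbon]) (intro lin_intros)
  also have "\<dots> = sum\<^sub>R (\<lambda>s t. \<epsilon> s *s \<epsilon> t *s sum\<^sub>R (\<lambda>s' t'. \<epsilon> s' *s \<epsilon> t' *s \<epsilon> v *s \<epsilon> v *s 1))"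
    by (simp add: tsum2_scale[symmetric] counit_mult mult_ac)
  also have "\<dots> = (\<epsilon> v * \<epsilon> v) *s 1"
    by (simp only: sum_counit_R) simp
  finally have "\<epsilon> v = \<epsilon> v * \<epsilon> v" by simp
  with nz show ?thesis by simp
qed

lemma drinfeld_commute: "u * a = S (S a) * u"
  unfolding u_def drinfeld_element_eq by (rule intertwiner_commute[OF sum_gamma])

lemma antipode_alpha_drinfeld: "S \<alpha> * u = \<gamma>"
  unfolding u_def drinfeld_element_eq by (rule antipode_alpha_intertwiner[OF sum_gamma])

text \<open>Apply S to \<open>u * b = S (S b) * u\<close> and put a = S(b); surjectivity of S
  reaches every a.\<close>

lemma antipode_drinfeld_commute: "S u * S (S a) = a * S u"
proof -
  obtain b where b: "a = S b" using antipode_bij by (metis bij_pointE)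
  show ?thesis
    unfolding b by (simp only: antipode_mult[symmetric] drinfeld_commute)
qed

lemma ribbon_alpha: "v * v * (S u * u) * \<alpha> = \<alpha>"
proof -
  have "\<alpha> = sum\<^sub>\<Delta> v (\<lambda>x y. S x * \<alpha> * y)"
    by (simp add: antipode_alpha counit_ribbon)
  also have "\<dots> = sum\<^sub>R (\<lambda>s t. sum\<^sub>R (\<lambda>s' t'. S (t * s' * v) * \<alpha> * (s * t' * v)))"
    by (rule sum_comult_ribbon[OF comult_ribbon]) (intro lin_intros)
  \<comment> \<open>Reversal by S makes the letters of R' enclose \<alpha>; their sum is
    \<gamma>.\<close>
  also have "\<dots> = sum\<^sub>R (\<lambda>s t. sum\<^sub>R (\<lambda>s' t'. S (s' * v) * (S t * \<alpha> * s) * (t' * v)))"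
    by (simp add: antipode_mult mult.assoc)
  also have "\<dots> = sum\<^sub>R (\<lambda>s' t'. S (s' * v) * \<gamma> * (t' * v))"
    by (rule lin_gamma) (intro lin_intros)
  \<comment> \<open>The letters of R surround \<gamma> in the opposite order. Writing \<gamma> =
    S(\<alpha>) u and moving u across t' turns each term into S of a summand of \<gamma>, times
    u.\<close>
  also have "\<dots> = sum\<^sub>R (\<lambda>s' t'. v * v * (S (S t' * \<alpha> * s') * u))"
  proof -
    have "S (s' * v) * \<gamma> * (t' * v) = v * v * (S (S t' * \<alpha> * s') * u)" for s' t'
    proof -
      have "S (s' * v) * \<gamma> * (t' * v) = v * (S s' * \<gamma> * t') * v"
        by (simp add: antipode_mult antipode_ribbon mult.assoc)
      also have "\<dots> = v * v * (S s' * \<gamma> * t')"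
        by (metis ribbon_central mult.assoc)
      also have "S s' * \<gamma> * t' = S s' * S \<alpha> * (u * t')"
        by (simp add: antipode_alpha_drinfeld[symmetric] mult.assoc)
      also have "\<dots> = S (S t' * \<alpha> * s') * u"
        by (simp add: drinfeld_commute antipode_mult mult.assoc)
      finally show ?thesis .
    qed
    then show ?thesis by (simp only:)
  qed
  also have "\<dots> = v * v * (S \<gamma> * u)"
    by (rule lin_gamma) (intro lin_intros)
  also have "S \<gamma> * u = S u * (S (S \<alpha>) * u)"
    by (simp only: antipode_alpha_drinfeld[symmetric] antipode_mult mult.assoc)
  also have "\<dots> = S u * u * \<alpha>"
    by (simp only: drinfeld_commute mult.assoc)
  finally show ?thesis by (simp only: mult.assoc)
qed

lemma ribbon_drinfeld: "v * v * (S u * u) = 1"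
proof -
  let ?c = "v * v * (S u * u)"
  have central: "?c * a = a * ?c" for a
  proof -
    \<comment> \<open>S(u) u a = S(u) S(S(a)) u = a S(u) u.\<close>
    have "S u * u * a = a * (S u * u)"
      by (metis drinfeld_commute antipode_drinfeld_commute mult.assoc)
    then show ?thesis by (metis ribbon_central mult.assoc)
  qed
  have "?c * (X * \<beta> * S Y * \<alpha> * Z) = X * \<beta> * S Y * \<alpha> * Z" for X Y Z
  proof -
    have "?c * (X * \<beta> * S Y * \<alpha> * Z) = (?c * (X * \<beta> * S Y)) * \<alpha> * Z"
      by (simp only: mult.assoc)
    \<comment> \<open>Centrality carries the coefficient to \<alpha>, which absorbs it.\<close>
    also have "\<dots> = X * \<beta> * S Y * (?c * \<alpha>) * Z"
      by (subst central[of "X * \<beta> * S Y"]) (simp only: mult.assoc)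
    finally show ?thesis by (simp only: ribbon_alpha)
  qed
  then have "?c * sum\<^sub>\<Phi> (\<lambda>X Y Z. X * \<beta> * S Y * \<alpha> * Z) = sum\<^sub>\<Phi> (\<lambda>X Y Z. X * \<beta> * S Y * \<alpha> * Z)"
    by (simp only: tsum3_mult_right)
  then show ?thesis by (simp add: antipode_Phi)
qed

text \<open>Since \<open>S\<^sup>2\<close> is surjective, \<open>A u = u A\<close>, so the left inverse of u yields a right inverse.\<close>

lemma drinfeld_antipode_commute: "u * S u = S u * u"
proof -
  \<comment> \<open>This preimage is a right inverse of u: u a = S(S(a)) u = v v S(u) u = 1.\<close>
  obtain a where a: "S (S a) = v * v * S u"
    using antipode_bij by (metis bij_pointE)
  have inv: "u * a = 1"
    using ribbon_drinfeld by (simp add: drinfeld_commute a mult.assoc)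
  \<comment> \<open>Both v v u S(u) and v v S(u) u become u after right multiplication by u, which
    the right inverse then cancels.\<close>
  have "v * v * (u * S u) * u = u * (v * v * (S u * u))"
    by (metis ribbon_central mult.assoc)
  also have "\<dots> = v * v * (S u * u) * u" by (simp add: ribbon_drinfeld)
  finally have "v * v * (u * S u) = v * v * (S u * u)"
    by (metis inv mult.assoc mult_1_right)
  \<comment> \<open>S(u) u is inverse to v v, so multiplication by it on the left removes v
    v.\<close>
  then have "(S u * u) * (v * v) * (u * S u) = (S u * u) * (v * v) * (S u * u)"
    by (simp only: mult.assoc)
  moreover have "(S u * u) * (v * v) = 1"
    using ribbon_drinfeld by (metis ribbon_central mult.assoc)
  ultimately show ?thesis by simp
qed

lemma ribbon_inverse_square: "\<exists>w. v * w = 1 \<and> w * v = 1 \<and> w ^ 2 = u * S u"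
proof (intro exI conjI)
  \<comment> \<open>The inverse of v is v times its inverse square, and the latter is S(u)
    u.\<close>
  let ?w = "v * (S u * u)"
  show "v * ?w = 1" using ribbon_drinfeld by (simp add: mult.assoc)
  then show "?w * v = 1" by (simp only: ribbon_central)
  have "?w ^ 2 = v * v * (S u * u) * (S u * u)"
    by (metis power2_eq_square ribbon_central mult.assoc)
  then show "?w ^ 2 = u * S u"
    by (simp add: ribbon_drinfeld drinfeld_antipode_commute)
qed

end

end

theorem theorem2p3:
  fixes scale :: "'k::field \<Rightarrow> 'a::ring_1 \<Rightarrow> 'a"
    and \<Delta> :: "'a \<Rightarrow> ('a, 'k) tensor"
    and \<epsilon> :: "'a \<Rightarrow> 'k"
    and \<Phi> R :: "('a, 'k) tensor"
    and S :: "'a \<Rightarrow> 'a"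
    and \<alpha> \<beta> u v :: 'a
  assumes "quasitriangular_quasi_hopf_algebra scale \<Delta> \<epsilon> \<Phi> S \<alpha> \<beta> R"
    and "u = k_algebra.drinfeld_element scale \<Phi> S \<alpha> \<beta> R"
    and "k_algebra.ribbon_element scale \<Delta> S R v"
  shows "\<exists>w. v * w = 1 \<and> w * v = 1 \<and> w ^ 2 = u * S u"
proof -
  interpret quasitriangular_quasi_hopf_algebra scale \<Delta> \<epsilon> \<Phi> S \<alpha> \<beta> R by fact
  show ?thesis
    unfolding assms(2) by (rule ribbon_inverse_square[OF assms(3)])
qed

end
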